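(* Let $F$ be a finitely ramified fractal with a resistance form $\mathcal E$ on $V_*$ for which all harmonic functions are continuous, and let $\nu$ be the Kusuoka energy measure and $Z_n$ the matrix-valued functions defined in the context. Then for $\nu$-almost all $x\in F$ there exists the limit $$Z(x)=\lim_{n\to\infty}Z_n(x).$$
   Context: **Finitely ramified fractal.** A finitely ramified fractal is a compact metric space $F$ with a cell structure $\{F_\alpha\}_{\alpha\in\mathcal A}$ and a vertex (boundary) structure $\{V_\alpha\}_{\alpha\in\mathcal A}$ such that: (A) $\mathcal A$ is a countable index set; (B) the $F_\alpha$ are pairwise distinct compact connected subsets of $F$; (C) each $V_\alpha$ is a finite subset of $F_\alpha$ with at least two elements; (D) if $F_\alpha=\bigcup_{j=1}^kF_{\alpha_j}$ then $V_\alpha\subset\bigcup_{j=1}^kV_{\alpha_j}$; (E) there is a filtration $\{\mathcal A_n\}_{n\ge0}$, $\mathcal A=\bigcup_n\mathcal A_n$, by pairwise disjoint finite sets $\mathcal A_n\subset\mathcal A$ with $\mathcal A_0=\{0\}$, $F_0=F$, and such that for every $\alpha\in\mathcal A_n$ there are $\alpha_1,\dots,\alpha_k\in\mathcal A_{n+1}$ with $F_\alpha=\bigcup_{j=1}^kF_{\alpha_j}$; (F) $F_{\alpha'}\cap F_\alpha=V_{\alpha'}\cap V_\alpha$ for any two distinct $\alpha,\alpha'\in\mathcal A_n$; (G) for any strictly decreasing infinite cell sequence $F_{\alpha_1}\supsetneq F_{\alpha_2}\supsetneq\cdots$ there is $x\in F$ with $\bigcap_{n\ge1}F_{\alpha_n}=\{x\}$.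 A filtration is fixed. Put $V_n=\bigcup_{\alpha\in\mathcal A_n}V_\alpha$ (so $V_n\subset V_{n+1}$) and $V_*=\bigcup_nV_n$. **Resistance form.** $\ell(V)$ is the space of real functions on $V$. A resistance form on the countable set $V_*$ is a pair $(\mathcal E,\mathrm{Dom}\,\mathcal E)$ such that: (RF1) $\mathrm{Dom}\,\mathcal E$ is a linear subspace of $\ell(V_* )$ containing constants, $\mathcal E$ is a nonnegative symmetric quadratic form on it, and $\mathcal E(u,u)=0$ iff $u$ is constant; (RF2) $\mathrm{Dom}\,\mathcal E$ modulo constants is a Hilbert space with respect to $\mathcal E$; (RF3) for every finite $V\subset V_*$ and $v\in\ell(V)$ there is $u\in\mathrm{Dom}\,\mathcal E$ with $u|_V=v$; (RF4) for all $p,q\in V_*$, $\sup\{(u(p)-u(q))^2/\mathcal E(u,u):u\in\mathrm{Dom}\,\mathcal E,\ \mathcal E(u,u)>0\}<\infty$; (RF5) for $u\in\mathrm{Dom}\,\mathcal E$, the function $\bar u=\max(0,\min(u,1))$ satisfies $\mathcal E(\bar u,\bar u)\le\mathcal E(u,u)$. For finite $U\subset V_*$ the trace is $\mathcal E_U(f,f)=\min\{\mathcal E(g,g):g\in\mathrm{Dom}\,\mathcal E,\ g|_U=f\}$. **Standing assumption.** $\mathcal E$ splits over cells: for each $\alpha$ the restriction $\mathcal E_\alpha$ of $\mathcal E$ to $F_\alpha$ is a resistance form on $V_*\cap F_\alpha$, and for each $n$, $f\in\mathrm{Dom}\,\mathcal E$ iff $f|_{V_*\cap F_\alpha}\in\mathrm{Dom}\,\mathcal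 E_\alpha$ for all $\alpha\in\mathcal A_n$, with $\mathcal E(f,f)=\sum_{\alpha\in\mathcal A_n}\mathcal E_\alpha(f|_{F_\alpha},f|_{F_\alpha})$ (and likewise each $\mathcal E_\alpha$ splits over the subcells of $F_\alpha$). With $\mathcal E_{V_\alpha}$ the trace of $\mathcal E_\alpha$ on $V_\alpha$ one has $\mathcal E_{V_n}=\sum_{\alpha\in\mathcal A_n}\mathcal E_{V_\alpha}$. **Harmonic functions.** $h\in\mathrm{Dom}\,\mathcal E$ is harmonic if it minimizes $\mathcal E$ among all functions in $\mathrm{Dom}\,\mathcal E$ with the same values on $V_0$; each function on $V_0$ has a unique harmonic extension. A function on $V_*$ is called continuous if it extends to a continuous function on $F$, and is then identified with this extension. Standing assumption: all harmonic functions are continuous. **Energy measure.** For harmonic $h$, $\nu_h$ is the unique atomless Borel measure on $F$ with $\nu_h(F_\alpha)=\mathcal E_{V_\alpha}(h|_{V_\alpha},h|_{V_\alpha})$ for all $\alpha\in\mathcal A$. Fix harmonic functions $h_1,\dots,h_k$, $k=|V_0|-1$, that are $\mathcal E$-orthonormal and together with constants span all harmonic functions. The Kusuoka energy measure is $\nu=\nu_{h_1}+\dots+\nu_{h_k}$. **The matrices $Z_n$.** $M_\alpha:\ell(V_0)\to\ell(V_\alpha)$ is the linear map sending $f$ to $h_f|_{V_\alpha}$, where $h_f$ is the harmonic function with $h_f|_{V_0}=f$. $D_\alpha$ is the symmetric matrix of $\mathcal E_{V_\alpha}$: $\mathcal E_{V_\alpha}(f,f)=\langle f,D_\alpha f\rangle$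 with the standard inner product of $\ell(V_\alpha)$. If $\nu(F_\alpha)\ne0$, put $Z_\alpha=M_\alpha^*D_\alpha M_\alpha/\nu(F_\alpha)$. Define $Z_n(x)=Z_\alpha$ if $\alpha\in\mathcal A_n$, $\nu(F_\alpha)\neq0$ and $x\in F_\alpha\setminus V_\alpha$. *)

theory Defs
  imports "HOL-Analysis.Analysis"
begin

section \<open>Finitely ramified fractals\<close>

text \<open>The compact metric space is a compact subset \<open>space_F\<close> of a metric space type; the
  filtration \<open>level\<close> is part of the data, and \<open>top_ix\<close> is the index of the whole space.\<close>

record ('i, 'a) fractal =
  space_F :: "'a set"
  indices :: "'i set"
  level :: "nat \<Rightarrow> 'i set"
  top_ix :: 'i
  cell :: "'i \<Rightarrow> 'a set"
  vert :: "'i \<Rightarrow> 'a set"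

definition finitely_ramified_fractal :: "('i, 'a::metric_space) fractal \<Rightarrow> bool" where
  "finitely_ramified_fractal K \<longleftrightarrow>
     compact (space_F K) \<and>
     countable (indices K) \<and>
     inj_on (cell K) (indices K) \<and>
     (\<forall>\<alpha>\<in>indices K. compact (cell K \<alpha>) \<and> connected (cell K \<alpha>) \<and> cell K \<alpha> \<subseteq> space_F K) \<and>
     (\<forall>\<alpha>\<in>indices K. finite (vert K \<alpha>) \<and> vert K \<alpha> \<subseteq> cell K \<alpha> \<and> card (vert K \<alpha>) \<ge> 2) \<and>
     (\<forall>\<alpha>\<in>indices K. \<forall>J. J \<subseteq> indices K \<and> finite J \<and> cell K \<alpha> = (\<Union>\<beta>\<in>J. cell K \<beta>)
        \<longrightarrow> vert K \<alpha> \<subseteq> (\<Union>\<beta>\<in>J. vert K \<beta>)) \<and>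
     indices K = (\<Union>n. level K n) \<and>
     (\<forall>n. finite (level K n)) \<and>
     (\<forall>m n. m \<noteq> n \<longrightarrow> level K m \<inter> level K n = {}) \<and>
     level K 0 = {top_ix K} \<and>
     cell K (top_ix K) = space_F K \<and>
     (\<forall>n. \<forall>\<alpha>\<in>level K n. \<exists>J. J \<subseteq> level K (Suc n) \<and> finite J \<and> cell K \<alpha> = (\<Union>\<beta>\<in>J. cell K \<beta>)) \<and>
     (\<forall>n. \<forall>\<alpha>\<in>level K n. \<forall>\<beta>\<in>level K n. \<alpha> \<noteq> \<beta> \<longrightarrow> cell K \<alpha> \<inter> cell K \<beta> = vert K \<alpha> \<inter> vert K \<beta>) \<and>
     (\<forall>s :: nat \<Rightarrow> 'i. (\<forall>n. s n \<in> indices K \<and> cell K (s (Suc n)) \<subset> cell K (s n))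
        \<longrightarrow> (\<exists>x\<in>space_F K. (\<Inter>n. cell K (s n)) = {x}))"

definition V_level :: "('i, 'a) fractal \<Rightarrow> nat \<Rightarrow> 'a set" where
  "V_level K n = (\<Union>\<alpha>\<in>level K n. vert K \<alpha>)"

definition V_star :: "('i, 'a) fractal \<Rightarrow> 'a set" where
  "V_star K = (\<Union>n. V_level K n)"


section \<open>Resistance forms\<close>

text \<open>A function on a set \<open>X\<close> is represented by its extension by zero.\<close>

definition ell :: "'a set \<Rightarrow> ('a \<Rightarrow> real) set" where
  "ell X = {u. \<forall>x. x \<notin> X \<longrightarrow> u x = 0}"

definition restr :: "('a \<Rightarrow> real) \<Rightarrow> 'a set \<Rightarrow> 'a \<Rightarrow> real" where
  "restr u X = (\<lambda>x. if x \<in> X then u x else 0)"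

record 'a form =
  dom_of :: "('a \<Rightarrow> real) set"
  energy :: "('a \<Rightarrow> real) \<Rightarrow> ('a \<Rightarrow> real) \<Rightarrow> real"

text \<open>The completeness clause says that every Cauchy sequence for \<open>energy\<close> converges for \<open>energy\<close>;
  this is completeness of the inner product space of domain functions modulo constants.\<close>

definition resistance_form :: "'a set \<Rightarrow> 'a form \<Rightarrow> bool" where
  "resistance_form X R \<longleftrightarrow>
     countable X \<and>
     dom_of R \<subseteq> ell X \<and>
     (\<forall>u\<in>dom_of R. \<forall>v\<in>dom_of R. \<forall>a b. (\<lambda>x. a * u x + b * v x) \<in> dom_of R) \<and>
     (\<forall>c. restr (\<lambda>_. c) X \<in> dom_of R) \<and>
     (\<forall>u\<in>dom_of R. \<forall>v\<in>dom_of R. energy R u v = energy R v u) \<and>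
     (\<forall>u\<in>dom_of R. \<forall>v\<in>dom_of R. \<forall>w\<in>dom_of R. \<forall>a b.
        energy R (\<lambda>x. a * u x + b * v x) w = a * energy R u w + b * energy R v w) \<and>
     (\<forall>u\<in>dom_of R. energy R u u \<ge> 0) \<and>
     (\<forall>u\<in>dom_of R. energy R u u = 0 \<longleftrightarrow> (\<exists>c. \<forall>x\<in>X. u x = c)) \<and>
     (\<forall>u :: nat \<Rightarrow> 'a \<Rightarrow> real.
        (\<forall>n. u n \<in> dom_of R) \<and>
        (\<forall>e>0. \<exists>N. \<forall>m\<ge>N. \<forall>n\<ge>N. energy R (\<lambda>x. u m x - u n x) (\<lambda>x. u m x - u n x) < e)
        \<longrightarrow> (\<exists>v\<in>dom_of R. (\<lambda>n. energy R (\<lambda>x. u n x - v x) (\<lambda>x. u n x - v x)) \<longlonglongrightarrow> 0)) \<and>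
     (\<forall>V v. finite V \<and> V \<subseteq> X \<longrightarrow> (\<exists>u\<in>dom_of R. \<forall>x\<in>V. u x = v x)) \<and>
     (\<forall>p\<in>X. \<forall>q\<in>X. bdd_above {(u p - u q)\<^sup>2 / energy R u u | u. u \<in> dom_of R \<and> energy R u u > 0}) \<and>
     (\<forall>u\<in>dom_of R. (\<lambda>x. max 0 (min (u x) 1)) \<in> dom_of R \<and>
        energy R (\<lambda>x. max 0 (min (u x) 1)) (\<lambda>x. max 0 (min (u x) 1)) \<le> energy R u u)"

text \<open>The trace on a finite set \<open>U\<close>, on the diagonal. Only the values of \<open>f\<close> on \<open>U\<close> matter;
  \<open>LEAST\<close> over the reals is the minimum.\<close>

definition trace_form :: "'a form \<Rightarrow> 'a set \<Rightarrow> ('a \<Rightarrow> real) \<Rightarrow> real" where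
  "trace_form R U f = (LEAST e. \<exists>g\<in>dom_of R. (\<forall>x\<in>U. g x = f x) \<and> e = energy R g g)"

text \<open>\<open>Ec \<alpha>\<close> is the restriction of the form \<open>E\<close> to the cell with index \<open>\<alpha>\<close>. The last clause is the
  splitting of \<open>Ec \<alpha>\<close> over the subcells at each finer level.\<close>

definition splits_over_cells :: "('i, 'a) fractal \<Rightarrow> 'a form \<Rightarrow> ('i \<Rightarrow> 'a form) \<Rightarrow> bool" where
  "splits_over_cells K E Ec \<longleftrightarrow>
     (\<forall>\<alpha>\<in>indices K. resistance_form (V_star K \<inter> cell K \<alpha>) (Ec \<alpha>)) \<and>
     (\<forall>n. \<forall>f\<in>ell (V_star K).
        (f \<in> dom_of E \<longleftrightarrow>
           (\<forall>\<alpha>\<in>level K n. restr f (V_star K \<inter> cell K \<alpha>) \<in> dom_of (Ec \<alpha>))) \<and>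
        (f \<in> dom_of E \<longrightarrow>
           energy E f f = (\<Sum>\<alpha>\<in>level K n.
             energy (Ec \<alpha>) (restr f (V_star K \<inter> cell K \<alpha>)) (restr f (V_star K \<inter> cell K \<alpha>))))) \<and>
     (\<forall>m n. m \<le> n \<longrightarrow> (\<forall>\<alpha>\<in>level K m. \<forall>f\<in>ell (V_star K \<inter> cell K \<alpha>).
        (f \<in> dom_of (Ec \<alpha>) \<longleftrightarrow>
           (\<forall>\<beta>\<in>{\<beta> \<in> level K n. cell K \<beta> \<subseteq> cell K \<alpha>}.
              restr f (V_star K \<inter> cell K \<beta>) \<in> dom_of (Ec \<beta>))) \<and>
        (f \<in> dom_of (Ec \<alpha>) \<longrightarrow>
           energy (Ec \<alpha>) f f = (\<Sum>\<beta>\<in>{\<beta> \<in> level K n. cell K \<beta> \<subseteq> cell K \<alpha>}.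
             energy (Ec \<beta>) (restr f (V_star K \<inter> cell K \<beta>)) (restr f (V_star K \<inter> cell K \<beta>))))))"


section \<open>Harmonic functions\<close>

definition harmonic :: "('i, 'a) fractal \<Rightarrow> 'a form \<Rightarrow> ('a \<Rightarrow> real) \<Rightarrow> bool" where
  "harmonic K E h \<longleftrightarrow> h \<in> dom_of E \<and>
     (\<forall>g\<in>dom_of E. (\<forall>x\<in>V_level K 0. g x = h x) \<longrightarrow> energy E h h \<le> energy E g g)"

definition harmonic_ext :: "('i, 'a) fractal \<Rightarrow> 'a form \<Rightarrow> ('a \<Rightarrow> real) \<Rightarrow> 'a \<Rightarrow> real" where
  "harmonic_ext K E f = (THE h. harmonic K E h \<and> (\<forall>x\<in>V_level K 0. h x = f x))"

definition extends_continuously :: "('i, 'a::metric_space) fractal \<Rightarrow> ('a \<Rightarrow> real) \<Rightarrow> bool" where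
  "extends_continuously K u \<longleftrightarrow>
     (\<exists>g. continuous_on (space_F K) g \<and> (\<forall>x\<in>V_star K. g x = u x))"

text \<open>The basis functions are \<open>h 1, \<dots>, h k\<close> with \<open>k = card (V_level K 0) - 1\<close>.\<close>

definition harmonic_basis :: "('i, 'a) fractal \<Rightarrow> 'a form \<Rightarrow> (nat \<Rightarrow> 'a \<Rightarrow> real) \<Rightarrow> bool" where
  "harmonic_basis K E h \<longleftrightarrow>
     (\<forall>i\<in>{1..card (V_level K 0) - 1}. harmonic K E (h i)) \<and>
     (\<forall>i\<in>{1..card (V_level K 0) - 1}. \<forall>j\<in>{1..card (V_level K 0) - 1}.
        energy E (h i) (h j) = (if i = j then 1 else 0)) \<and>
     (\<forall>u. harmonic K E u \<longrightarrow> (\<exists>c0 c. \<forall>x\<in>V_star K.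
        u x = c0 + (\<Sum>i\<in>{1..card (V_level K 0) - 1}. c i * h i x)))"


section \<open>Energy measures\<close>

definition atomless :: "'a measure \<Rightarrow> bool" where
  "atomless M \<longleftrightarrow> (\<forall>S\<in>sets M. emeasure M S > 0 \<longrightarrow>
     (\<exists>T\<in>sets M. T \<subseteq> S \<and> 0 < emeasure M T \<and> emeasure M T < emeasure M S))"

definition energy_measure ::
  "('i, 'a::metric_space) fractal \<Rightarrow> ('i \<Rightarrow> 'a form) \<Rightarrow> ('a \<Rightarrow> real) \<Rightarrow> 'a measure \<Rightarrow> bool" where
  "energy_measure K Ec h M \<longleftrightarrow>
     sets M = sets (restrict_space borel (space_F K)) \<and>
     atomless M \<and>
     (\<forall>\<alpha>\<in>indices K. emeasure M (cell K \<alpha>) = ennreal (trace_form (Ec \<alpha>) (vert K \<alpha>) h))"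

definition kusuoka_measure ::
  "('i, 'a::metric_space) fractal \<Rightarrow> (nat \<Rightarrow> 'a measure) \<Rightarrow> 'a measure" where
  "kusuoka_measure K M =
     measure_of (space_F K) (sets (restrict_space borel (space_F K)))
       (\<lambda>S. \<Sum>i\<in>{1..card (V_level K 0) - 1}. emeasure (M i) S)"


section \<open>The matrices\<close>

text \<open>Matrices with rows indexed by \<open>U\<close> and columns indexed by \<open>W\<close> are functions
  \<open>'a \<Rightarrow> 'a \<Rightarrow> real\<close> of which only the entries in \<open>U \<times> W\<close> are used.\<close>

definition M_map :: "('i, 'a) fractal \<Rightarrow> 'a form \<Rightarrow> 'i \<Rightarrow> ('a \<Rightarrow> real) \<Rightarrow> 'a \<Rightarrow> real" where
  "M_map K E \<alpha> f = restr (harmonic_ext K E f) (vert K \<alpha>)"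

definition M_mat :: "('i, 'a) fractal \<Rightarrow> 'a form \<Rightarrow> 'i \<Rightarrow> 'a \<Rightarrow> 'a \<Rightarrow> real" where
  "M_mat K E \<alpha> s p = M_map K E \<alpha> (indicator {p}) s"

definition D_mat :: "('i, 'a) fractal \<Rightarrow> ('i \<Rightarrow> 'a form) \<Rightarrow> 'i \<Rightarrow> 'a \<Rightarrow> 'a \<Rightarrow> real" where
  "D_mat K Ec \<alpha> = (THE D.
     (\<forall>s t. D s t = D t s) \<and>
     (\<forall>s t. s \<notin> vert K \<alpha> \<or> t \<notin> vert K \<alpha> \<longrightarrow> D s t = 0) \<and>
     (\<forall>f. trace_form (Ec \<alpha>) (vert K \<alpha>) f =
        (\<Sum>s\<in>vert K \<alpha>. f s * (\<Sum>t\<in>vert K \<alpha>. D s t * f t))))"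

definition Z_mat ::
  "('i, 'a) fractal \<Rightarrow> 'a form \<Rightarrow> ('i \<Rightarrow> 'a form) \<Rightarrow> 'a measure \<Rightarrow> 'i \<Rightarrow> 'a \<Rightarrow> 'a \<Rightarrow> real" where
  "Z_mat K E Ec \<nu> \<alpha> p q =
     (\<Sum>s\<in>vert K \<alpha>. \<Sum>t\<in>vert K \<alpha>. M_mat K E \<alpha> s p * D_mat K Ec \<alpha> s t * M_mat K E \<alpha> t q)
       / measure \<nu> (cell K \<alpha>)"

text \<open>\<open>Z_fun K E Ec \<nu> n\<close> is a partial function: \<open>Z_index\<close> relates a point of its domain to the index
  of the cell that determines the value, and outside the domain the value is meaningless.
  The index is unique, because distinct cells of one level meet only in their vertices.\<close>

definition Z_index :: "('i, 'a) fractal \<Rightarrow> 'a measure \<Rightarrow> nat \<Rightarrow> 'a \<Rightarrow> 'i \<Rightarrow> bool" where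
  "Z_index K \<nu> n x \<alpha> \<longleftrightarrow>
     \<alpha> \<in> level K n \<and> emeasure \<nu> (cell K \<alpha>) \<noteq> 0 \<and> x \<in> cell K \<alpha> - vert K \<alpha>"

definition Z_fun ::
  "('i, 'a) fractal \<Rightarrow> 'a form \<Rightarrow> ('i \<Rightarrow> 'a form) \<Rightarrow> 'a measure \<Rightarrow> nat \<Rightarrow> 'a \<Rightarrow> 'a \<Rightarrow> 'a \<Rightarrow> real" where
  "Z_fun K E Ec \<nu> n x = Z_mat K E Ec \<nu> (THE \<alpha>. Z_index K \<nu> n x \<alpha>)"

end

theory Submission
  imports Defs
begin

text \<open>
  The idea is to express the entries of \<open>Z_n\<close> by nonnegative supermartingales. Let \<open>u\<close> be harmonic and write
  \<open>E_\<alpha>(u)\<close> for the energy of \<open>u\<close> on the cell \<open>\<alpha>\<close>. A harmonic function minimizes the energy on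
  every cell among the functions with the same values at the vertices of that cell: a competitor on one
  cell can be glued to \<open>u\<close> outside, as cells of one level meet only in vertices. So
  \<open>E_\<alpha>(u)\<close> is also the trace of the form on the vertices of \<open>\<alpha>\<close>, evaluated at \<open>u\<close>
  (\<open>trace_form_harmonic\<close>). With \<open>u_p\<close> the harmonic function whose boundary values are the
  indicator of \<open>p\<close>, polarization turns the \<open>(p, q)\<close> entry of \<open>Z_\<alpha>\<close> into
  \<open>(E_\<alpha>(u_p + u_q) - E_\<alpha>(u_p) - E_\<alpha>(u_q)) / (2 \<nu>(F_\<alpha>))\<close> (\<open>Z_mat_eq_cell_energy\<close>).
  It remains to see that \<open>E_\<alpha>(u) / \<nu>(F_\<alpha>)\<close>, along the cells \<open>\<alpha>\<close> that contain \<open>x\<close>, converges for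
  almost every \<open>x\<close> whenever \<open>u\<close> is harmonic.

  The energy of a cell is the sum of the energies of its subcells, and \<open>\<nu>\<close> is additive as well
  because the overlaps lie in the countable null set \<open>V_*\<close>. Therefore the ratio is a nonnegative
  supermartingale for the filtration generated by the cells of level \<open>n\<close>: its mean over a cell is
  preserved under subdivision, up to the energy of subcells of measure zero
  (\<open>energy_ratio_supermartingale\<close>).

  That nonnegative supermartingales converge almost everywhere
  (\<open>nonneg_supermartingale_AE_convergent\<close>) is proved with Dubins' inequality: the points with
  \<open>k\<close> upcrossings of an interval \<open>[a, b]\<close> have at most the share \<open>(a / b)^k\<close> of the total mass. The inequality comes from a
  single nonnegative process whose integral never exceeds the total mass and that has the value \<open>(b / a)^k\<close> once the
  \<open>k\<close> upcrossings are complete.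

  Two facts about a resistance form underlie the definitions of the harmonic extension and of the
  matrix of a trace: prescribed values on a finite set have a unique extension of minimal energy, and
  it depends linearly on the values (\<open>harmonic_off_exists\<close>, \<open>harmonic_off_unique\<close>,
  \<open>trace_form_matrix\<close>).
\<close>

section \<open>Almost everywhere convergence of nonnegative supermartingales\<close>

text \<open>An even state waits for a value below \<open>a\<close>, an odd one for a value above \<open>b\<close>; so the state \<open>2 * j\<close>
  means that \<open>j\<close> upcrossings are complete. The state \<open>2 * k\<close> is absorbing, so that the
  crossing potential keeps the value \<open>(b / a)^k\<close> once it is reached.\<close>

primrec crossing_state :: "real \<Rightarrow> real \<Rightarrow> nat \<Rightarrow> (nat \<Rightarrow> real) \<Rightarrow> nat \<Rightarrow> nat" where
  "crossing_state a b k y 0 = 0"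
| "crossing_state a b k y (Suc n) =
     (let j = crossing_state a b k y n in
      if even j \<and> j < 2 * k \<and> y (Suc n) < a \<or> odd j \<and> y (Suc n) > b then Suc j else j)"

lemma crossing_state_le: "crossing_state a b k y n \<le> 2 * k"
proof (induction n)
  case (Suc n)
  \<comment> \<open>The bound is even, so an odd state lies strictly below it.\<close>
  have "odd j \<Longrightarrow> j \<le> 2 * k \<Longrightarrow> Suc j \<le> 2 * k" for j :: nat
    by presburger
  with Suc show ?case by (auto simp: Let_def)
qed simp

lemma crossing_state_reaches:
  assumes below: "\<exists>\<^sub>F n in sequentially. y n < a" and above: "\<exists>\<^sub>F n in sequentially. y n > b"
  shows "j \<le> 2 * k \<Longrightarrow> \<exists>n. crossing_state a b k y n = j"
proof (induction j)
  case 0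
  show ?case by (rule exI[of _ 0]) simp
next
  case (Suc j)
  then obtain n where n: "crossing_state a b k y n = j" by auto
  show ?case
  proof (rule ccontr)
    assume never: "\<nexists>n. crossing_state a b k y n = Suc j"
    have stay: "crossing_state a b k y (n + i) = j" for i
    proof (induction i)
      case (Suc i)
      have "crossing_state a b k y (Suc (n + i)) \<noteq> Suc j" using never by blast
      with Suc show ?case by (auto simp: Let_def split: if_splits)
    qed (simp add: n)
    have "\<exists>m>n. if even j then y m < a else y m > b"
      using below above by (auto simp: frequently_sequentially) (meson Suc_le_eq)+
    then obtain m where m: "m > n" "if even j then y m < a else y m > b" by blast
    then obtain i where i: "m = Suc (n + i)" by (metis less_imp_Suc_add)
    have "crossing_state a b k y (Suc (n + i)) = Suc j"
      using m(2) Suc.prems stay[of i] unfolding i by (auto simp: Let_def)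
    with never show False by blast
  qed
qed

text \<open>The wealth of a gambler who holds one unit of money at the start, invests everything in the
  process \<open>y\<close> when an upcrossing starts and sells when it ends. The gambler always pays the price \<open>a\<close>
  and receives the price \<open>b\<close>; the better actual prices only make the wealth drop at a trade.\<close>

definition crossing_potential ::
  "real \<Rightarrow> real \<Rightarrow> nat \<Rightarrow> (nat \<Rightarrow> real) \<Rightarrow> nat \<Rightarrow> real" where
  "crossing_potential a b k y n =
     (let j = crossing_state a b k y n
      in (b / a) ^ (j div 2) * (if even j then 1 else y n / a))"

text \<open>The right-hand side is the wealth before a possible trade at time \<open>Suc n\<close>. A trade only discards
  money: a purchase at \<open>y < a\<close> replaces the factor \<open>1\<close> by \<open>y / a\<close>, and a sale at
  \<open>y > b\<close> replaces the factor \<open>y / a\<close> by \<open>b / a\<close>.\<close>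

lemma crossing_potential_step:
  assumes "0 < a" "a < b"
  shows "crossing_potential a b k y (Suc n) \<le>
     (let j = crossing_state a b k y n
      in (b / a) ^ (j div 2) * (if even j then 1 else y (Suc n) / a))"
proof -
  have "Suc j div 2 = Suc (j div 2)" if "odd j" for j :: nat using that by presburger
  moreover have "Suc j div 2 = j div 2" if "even j" for j :: nat using that by presburger
  ultimately show ?thesis
    using assms
    by (auto simp: crossing_potential_def Let_def field_simps intro!: mult_left_mono)
qed

text \<open>Whether the gambler holds the process during a step is decided by the past, so the expected wealth
  does not increase.\<close>

lemma (in finite_measure) integral_crossing_potential_le:
  fixes X :: "nat \<Rightarrow> 'a \<Rightarrow> real" and F :: "nat \<Rightarrow> 'a measure"
  assumes spF: "\<And>n. space (F n) = space M" and FM: "\<And>n. sets (F n) \<subseteq> sets M"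
    and mono: "\<And>n. sets (F n) \<subseteq> sets (F (Suc n))"
    and X[measurable]: "\<And>n. X n \<in> borel_measurable (F n)"
    and nonneg: "\<And>n x. x \<in> space M \<Longrightarrow> 0 \<le> X n x"
    and super: "\<And>n A. A \<in> sets (F n) \<Longrightarrow>
        (\<integral>\<^sup>+x\<in>A. ennreal (X (Suc n) x) \<partial>M) \<le> (\<integral>\<^sup>+x\<in>A. ennreal (X n x) \<partial>M)"
    and ab: "0 < a" "a < b"
  shows "(\<integral>\<^sup>+x. ennreal (crossing_potential a b k (\<lambda>n. X n x) n) \<partial>M) \<le> emeasure M (space M)"
proof -
  define S where "S n x = crossing_state a b k (\<lambda>n. X n x) n" for n x
  have [measurable]: "S n \<in> measurable (F n) (count_space UNIV)" for n
  proof (induction n)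
    case 0 show ?case by (simp add: S_def[abs_def])
  next
    case (Suc n)
    have [measurable]: "S n \<in> measurable (F (Suc n)) (count_space UNIV)"
      using Suc mono[of n] spF by (auto simp: measurable_def)
    show ?case unfolding S_def[abs_def] crossing_state.simps Let_def unfolding S_def[symmetric]
      by measurable
  qed
  have XM[measurable]: "X n \<in> borel_measurable M" for n
    using X[of n] FM[of n] spF by (auto simp: measurable_def)
  have SF: "{x \<in> space M. S n x = j} \<in> sets (F n)" for n j
  proof -
    have "{x \<in> space (F n). S n x = j} \<in> sets (F n)" by measurable
    then show ?thesis by (simp add: spF)
  qed
  have [measurable]: "{x \<in> space M. S n x = j} \<in> sets M" for n j
    using SF FM by blast
  \<comment> \<open>The wealth in state \<open>j\<close> when the process has the value \<open>z\<close>: holding the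
      state fixed while \<open>z\<close> moves separates the trade from the step of the process.\<close>
  define w where "w j z = (b / a) ^ (j div 2) * (if even j then 1 else z / a)"
    for j :: nat and z :: real
  have split: "(\<integral>\<^sup>+x. ennreal (w (S n x) (X m x)) \<partial>M) =
      (\<Sum>j\<le>2*k. \<integral>\<^sup>+x\<in>{x \<in> space M. S n x = j}. ennreal (w j (X m x)) \<partial>M)" for n m
  proof -
    have "(\<integral>\<^sup>+x. ennreal (w (S n x) (X m x)) \<partial>M) =
      (\<integral>\<^sup>+x. (\<Sum>j\<le>2*k. ennreal (w j (X m x)) * indicator {x \<in> space M. S n x = j} x) \<partial>M)"
    proof (rule nn_integral_cong)
      fix x assume x: "x \<in> space M"
      have "(\<Sum>j\<le>2*k. ennreal (w j (X m x)) * indicator {x \<in> space M. S n x = j} x) =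
         (\<Sum>j\<le>2*k. if j = S n x then ennreal (w j (X m x)) else 0)"
        using x by (intro sum.cong) (auto simp: indicator_def)
      also have "\<dots> = ennreal (w (S n x) (X m x))"
        using crossing_state_le[of a b k "\<lambda>n. X n x" n] by (simp add: S_def)
      finally show "ennreal (w (S n x) (X m x)) =
         (\<Sum>j\<le>2*k. ennreal (w j (X m x)) * indicator {x \<in> space M. S n x = j} x)" ..
    qed
    also have "\<dots> = (\<Sum>j\<le>2*k. \<integral>\<^sup>+x\<in>{x \<in> space M. S n x = j}. ennreal (w j (X m x)) \<partial>M)"
      unfolding w_def by (rule nn_integral_sum) measurable
    finally show ?thesis .
  qed
  have piece: "(\<integral>\<^sup>+x\<in>{x \<in> space M. S n x = j}. ennreal (w j (X (Suc n) x)) \<partial>M)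
      \<le> (\<integral>\<^sup>+x\<in>{x \<in> space M. S n x = j}. ennreal (w j (X n x)) \<partial>M)" for n j
  proof (cases "even j")
    case True then show ?thesis by (simp add: w_def)
  next
    case False
    define c where "c = ennreal ((b / a) ^ (j div 2) / a)"
    have w: "(\<integral>\<^sup>+x\<in>{x \<in> space M. S n x = j}. ennreal (w j (X m x)) \<partial>M) =
        c * (\<integral>\<^sup>+x\<in>{x \<in> space M. S n x = j}. ennreal (X m x) \<partial>M)" for m
    proof -
      have "(\<integral>\<^sup>+x\<in>{x \<in> space M. S n x = j}. ennreal (w j (X m x)) \<partial>M) =
        (\<integral>\<^sup>+x. c * (ennreal (X m x) * indicator {x \<in> space M. S n x = j} x) \<partial>M)"
      proof (rule nn_integral_cong)
        fix x assume "x \<in> space M"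
        have "ennreal (w j (X m x)) = c * ennreal (X m x)"
          using nonneg[OF \<open>x \<in> space M\<close>, of m] ab False
          by (simp add: w_def c_def ennreal_mult[symmetric])
        then show "ennreal (w j (X m x)) * indicator {x \<in> space M. S n x = j} x =
           c * (ennreal (X m x) * indicator {x \<in> space M. S n x = j} x)"
          by (simp add: mult.assoc)
      qed
      also have "\<dots> = c * (\<integral>\<^sup>+x\<in>{x \<in> space M. S n x = j}. ennreal (X m x) \<partial>M)"
        by (rule nn_integral_cmult) measurable
      finally show ?thesis .
    qed
    show ?thesis unfolding w by (intro mult_left_mono super SF) simp
  qed
  show ?thesis
  proof (induction n)
    case 0
    have "(\<integral>\<^sup>+x. ennreal (crossing_potential a b k (\<lambda>n. X n x) 0) \<partial>M) = (\<integral>\<^sup>+x. 1 \<partial>M)"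
      by (simp add: crossing_potential_def)
    then show ?case by simp
  next
    case (Suc n)
    have "(\<integral>\<^sup>+x. ennreal (crossing_potential a b k (\<lambda>n. X n x) (Suc n)) \<partial>M)
        \<le> (\<integral>\<^sup>+x. ennreal (w (S n x) (X (Suc n) x)) \<partial>M)"
      unfolding w_def S_def
      by (intro nn_integral_mono ennreal_leI crossing_potential_step[OF ab, unfolded Let_def])
    also have "\<dots> \<le> (\<integral>\<^sup>+x. ennreal (w (S n x) (X n x)) \<partial>M)"
      unfolding split by (intro sum_mono piece)
    also have "\<dots> = (\<integral>\<^sup>+x. ennreal (crossing_potential a b k (\<lambda>n. X n x) n) \<partial>M)"
      by (simp add: w_def S_def crossing_potential_def Let_def)
    finally show ?case using Suc by simp
  qed
qed


lemma convergent_if_no_crossings: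
  fixes y :: "nat \<Rightarrow> real"
  assumes nonneg: "\<And>n. 0 \<le> y n" and fin: "liminf (\<lambda>n. ennreal (y n)) < \<infinity>"
    and cross: "\<And>a b. a \<in> \<rat> \<Longrightarrow> b \<in> \<rat> \<Longrightarrow> 0 < a \<Longrightarrow> a < b \<Longrightarrow>
        \<not> ((\<exists>\<^sub>F n in sequentially. y n < a) \<and> (\<exists>\<^sub>F n in sequentially. y n > b))"
  shows "convergent y"
proof -
  define l where "l = enn2real (liminf (\<lambda>n. ennreal (y n)))"
  have l: "liminf (\<lambda>n. ennreal (y n)) = ennreal l"
    using fin by (simp add: l_def less_top)
  have l0: "0 \<le> l" by (simp add: l_def)
  have lower: "\<forall>\<^sub>F n in sequentially. c < y n" if "c < l" for c
  proof (cases "c < 0")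
    case True
    then have "c < y n" for n using nonneg[of n] by linarith
    then show ?thesis by simp
  next
    case False
    then have "ennreal c < liminf (\<lambda>n. ennreal (y n))"
      using that unfolding l by (simp add: ennreal_less_iff)
    from less_LiminfD[OF this] show ?thesis
      using False by (simp add: ennreal_less_iff)
  qed
  have below: "\<exists>\<^sub>F n in sequentially. y n < c" if "l < c" for c
  proof (rule ccontr)
    assume "\<not> (\<exists>\<^sub>F n in sequentially. y n < c)"
    then have "\<forall>\<^sub>F n in sequentially. ennreal c \<le> ennreal (y n)"
      by (auto simp: not_frequently not_less elim!: eventually_mono intro: ennreal_leI)
    then have "ennreal c \<le> ennreal l" unfolding l[symmetric] by (rule Liminf_bounded)
    with that l0 show False by simp
  qed
  have upper: "\<forall>\<^sub>F n in sequentially. y n < c" if lc: "l < c" for c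
  proof -
    obtain b where b: "b \<in> \<rat>" "l < b" "b < c" using Rats_dense_in_real[OF lc] by auto
    obtain a where a: "a \<in> \<rat>" "l < a" "a < b" using Rats_dense_in_real[OF b(2)] by auto
    have "\<not> (\<exists>\<^sub>F n in sequentially. y n > b)"
      using cross[OF a(1) b(1)] below[OF a(2)] a l0 by auto
    then show ?thesis using b(3) by (auto simp: not_frequently elim!: eventually_mono)
  qed
  have "y \<longlonglongrightarrow> l" by (rule order_tendstoI) (use lower upper in auto)
  then show ?thesis by (rule convergentI)
qed

text \<open>Fatou's lemma makes the lower limit finite almost everywhere, and the crossing potential excludes
  infinitely many upcrossings of each of the countably many rational intervals.\<close>

theorem (in finite_measure) nonneg_supermartingale_AE_convergent:
  fixes X :: "nat \<Rightarrow> 'a \<Rightarrow> real" and F :: "nat \<Rightarrow> 'a measure"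
  assumes spF: "\<And>n. space (F n) = space M" and FM: "\<And>n. sets (F n) \<subseteq> sets M"
    and mono: "\<And>n. sets (F n) \<subseteq> sets (F (Suc n))"
    and X: "\<And>n. X n \<in> borel_measurable (F n)"
    and nonneg: "\<And>n x. x \<in> space M \<Longrightarrow> 0 \<le> X n x"
    and super: "\<And>n A. A \<in> sets (F n) \<Longrightarrow>
        (\<integral>\<^sup>+x\<in>A. ennreal (X (Suc n) x) \<partial>M) \<le> (\<integral>\<^sup>+x\<in>A. ennreal (X n x) \<partial>M)"
    and fin: "(\<integral>\<^sup>+x. ennreal (X 0 x) \<partial>M) < \<infinity>"
  shows "AE x in M. convergent (\<lambda>n. X n x)"
proof -
  have XM[measurable]: "X n \<in> borel_measurable M" for n
    using X[of n] FM[of n] spF by (auto simp: measurable_def)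
  have space_F: "space M \<in> sets (F n)" for n using sets.top[of "F n"] spF by simp
  have dec: "(\<integral>\<^sup>+x. ennreal (X n x) \<partial>M) \<le> (\<integral>\<^sup>+x. ennreal (X 0 x) \<partial>M)" for n
  proof (induction n)
    case (Suc n)
    have "(\<integral>\<^sup>+x. ennreal (X m x) \<partial>M) = (\<integral>\<^sup>+x\<in>space M. ennreal (X m x) \<partial>M)" for m
      by (rule nn_integral_cong) simp
    then show ?case using super[OF space_F, of n] Suc by simp
  qed simp
  have "(\<integral>\<^sup>+x. liminf (\<lambda>n. ennreal (X n x)) \<partial>M) \<le> liminf (\<lambda>n. \<integral>\<^sup>+x. ennreal (X n x) \<partial>M)"
    by (rule nn_integral_liminf) measurable
  also have "\<dots> \<le> (\<integral>\<^sup>+x. ennreal (X 0 x) \<partial>M)"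
    using dec by (intro Liminf_le) (auto intro!: always_eventually)
  finally have "(\<integral>\<^sup>+x. liminf (\<lambda>n. ennreal (X n x)) \<partial>M) \<noteq> \<infinity>" using fin by (auto simp: top_unique)
  then have finite_liminf: "AE x in M. liminf (\<lambda>n. ennreal (X n x)) \<noteq> \<infinity>"
    by (intro nn_integral_PInf_AE) measurable
  \<comment> \<open>Dubins' inequality: the potential equals \<open>(b / a)^k\<close> in the absorbing state, so that
      state is reached on a set of measure at most \<open>(a / b)^k\<close> times the total mass, for every \<open>k\<close>.\<close>
  have no_crossing: "AE x in M. \<not> ((\<exists>\<^sub>F n in sequentially. X n x < a) \<and>
      (\<exists>\<^sub>F n in sequentially. X n x > b))" if ab: "0 < a" "a < b" for a b
  proof -
    define N where "N = {x \<in> space M. (\<exists>\<^sub>F n in sequentially. X n x < a) \<and>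
      (\<exists>\<^sub>F n in sequentially. X n x > b)}"
    have [measurable]: "N \<in> sets M"
      unfolding N_def frequently_sequentially by measurable
    define S where "S k n x = crossing_state a b k (\<lambda>n. X n x) n" for k n x
    have [measurable]: "S k n \<in> measurable M (count_space UNIV)" for k n
    proof (induction n)
      case 0 show ?case by (simp add: S_def[abs_def])
    next
      case (Suc n) note [measurable] = Suc
      show ?case unfolding S_def[abs_def] crossing_state.simps Let_def unfolding S_def[symmetric]
        by measurable
    qed
    have bound: "emeasure M N \<le> ennreal ((a / b) ^ k) * emeasure M (space M)" for k
    proof -
      define T where "T n = {x \<in> space M. S k n x = 2 * k}" for n
      have [measurable]: "T n \<in> sets M" for n unfolding T_def by measurable
      have "incseq T"
      proof (rule incseq_SucI, rule subsetI)
        fix n x assume "x \<in> T n"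
        then show "x \<in> T (Suc n)" by (simp add: T_def S_def Let_def)
      qed
      have "N \<subseteq> (\<Union>n. T n)"
      proof
        fix x assume "x \<in> N"
        then have "\<exists>n. crossing_state a b k (\<lambda>n. X n x) n = 2 * k" and "x \<in> space M"
          unfolding N_def by (auto intro: crossing_state_reaches)
        then show "x \<in> (\<Union>n. T n)" by (auto simp: T_def S_def)
      qed
      then have "emeasure M N \<le> emeasure M (\<Union>n. T n)"
        by (rule emeasure_mono) measurable
      also have "\<dots> = (SUP n. emeasure M (T n))"
        using \<open>incseq T\<close> by (subst SUP_emeasure_incseq) auto
      also have "\<dots> \<le> ennreal ((a / b) ^ k) * emeasure M (space M)"
      proof (rule SUP_least)
        fix n
        have "emeasure M (T n) = (\<integral>\<^sup>+x. indicator (T n) x \<partial>M)" by simp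
        also have "\<dots> \<le> (\<integral>\<^sup>+x. ennreal ((a / b) ^ k) *
            ennreal (crossing_potential a b k (\<lambda>n. X n x) n) \<partial>M)"
        proof (rule nn_integral_mono)
          fix x assume x: "x \<in> space M"
          have "crossing_potential a b k (\<lambda>n. X n x) n = (b / a) ^ k" if "x \<in> T n"
            using that by (simp add: T_def S_def crossing_potential_def)
          moreover have "(a / b) ^ k * (b / a) ^ k = 1"
            using ab by (simp add: power_mult_distrib[symmetric])
          ultimately show "indicator (T n) x \<le> ennreal ((a / b) ^ k) *
              ennreal (crossing_potential a b k (\<lambda>n. X n x) n)"
            using ab by (auto simp: indicator_def ennreal_mult[symmetric])
        qed
        also have "\<dots> = ennreal ((a / b) ^ k) *
            (\<integral>\<^sup>+x. ennreal (crossing_potential a b k (\<lambda>n. X n x) n) \<partial>M)"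
          unfolding crossing_potential_def S_def[symmetric] Let_def
          by (rule nn_integral_cmult) measurable
        also have "\<dots> \<le> ennreal ((a / b) ^ k) * emeasure M (space M)"
          using integral_crossing_potential_le[where F = F and X = X and k = k and n = n,
              OF spF FM mono X nonneg super ab]
          by (intro mult_left_mono) auto
        finally show "emeasure M (T n) \<le> ennreal ((a / b) ^ k) * emeasure M (space M)" .
      qed
      finally show ?thesis .
    qed
    have "(\<lambda>k. ennreal ((a / b) ^ k * measure M (space M))) \<longlonglongrightarrow> ennreal (0 * measure M (space M))"
      using ab by (intro tendsto_ennrealI tendsto_mult LIMSEQ_power_zero tendsto_const) auto
    moreover have "emeasure M N \<le> ennreal ((a / b) ^ k * measure M (space M))" for k
      using bound[of k] ab by (simp add: emeasure_eq_measure ennreal_mult)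
    ultimately have "emeasure M N \<le> 0"
      by (intro LIMSEQ_le_const) auto
    then have "N \<in> null_sets M" by (auto simp: null_sets_def)
    then show ?thesis by (rule AE_I') (auto simp: N_def)
  qed
  have "AE x in M. \<forall>a\<in>\<rat>. \<forall>b\<in>\<rat>. 0 < a \<longrightarrow> a < b \<longrightarrow>
      \<not> ((\<exists>\<^sub>F n in sequentially. X n x < a) \<and> (\<exists>\<^sub>F n in sequentially. X n x > b))"
    using no_crossing by (auto simp: AE_ball_countable countable_rat)
  then show ?thesis using finite_liminf AE_space
  proof eventually_elim
    case (elim x)
    show ?case
      by (rule convergent_if_no_crossings) (use elim nonneg in \<open>auto simp: less_top\<close>)
  qed
qed

section \<open>Energy minimizers of a resistance form\<close>

lemma nonneg_quadratic_discriminant: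
  fixes A B C :: real
  assumes nonneg: "\<And>t. 0 \<le> A + 2 * t * B + t\<^sup>2 * C" and "0 \<le> C"
  shows "B\<^sup>2 \<le> A * C"
proof (cases "C = 0")
  case True
  have "B = 0"
  proof (rule ccontr)
    assume "B \<noteq> 0"
    then show False using nonneg[of "- (A + 1) / (2 * B)"] True by (simp add: field_simps)
  qed
  with True show ?thesis by simp
next
  case False
  with \<open>0 \<le> C\<close> have "C > 0" by simp
  have "0 \<le> (A + 2 * (- B / C) * B + (- B / C)\<^sup>2 * C) * C"
    using nonneg[of "- B / C"] \<open>C > 0\<close> by (intro mult_nonneg_nonneg) auto
  also have "\<dots> = A * C - B\<^sup>2"
    using \<open>C > 0\<close> by (simp add: field_simps power2_eq_square)
  finally show ?thesis by simp
qed

text \<open>The weak form of being an energy minimizer for the given values on \<open>U\<close>, see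
  \<open>harmonic_off_iff_minimizer\<close>. Unlike the minimization property, it is visibly linear in
  \<open>g\<close>.\<close>

definition harmonic_off :: "'a form \<Rightarrow> 'a set \<Rightarrow> ('a \<Rightarrow> real) \<Rightarrow> bool" where
  "harmonic_off R U g \<longleftrightarrow> g \<in> dom_of R \<and>
     (\<forall>w\<in>dom_of R. (\<forall>x\<in>U. w x = 0) \<longrightarrow> energy R g w = 0)"

locale resistance_space =
  fixes X :: "'a set" and R :: "'a form"
  assumes rf: "resistance_form X R"
begin

lemma dom_ell: "u \<in> dom_of R \<Longrightarrow> u \<in> ell X"
  using rf by (auto simp: resistance_form_def)

lemma dom_lincomb: "u \<in> dom_of R \<Longrightarrow> v \<in> dom_of R \<Longrightarrow> (\<lambda>x. a * u x + b * v x) \<in> dom_of R"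
  using rf by (auto simp: resistance_form_def)

lemma dom_add: "u \<in> dom_of R \<Longrightarrow> v \<in> dom_of R \<Longrightarrow> (\<lambda>x. u x + v x) \<in> dom_of R"
  using dom_lincomb[of u v 1 1] by simp

lemma dom_diff: "u \<in> dom_of R \<Longrightarrow> v \<in> dom_of R \<Longrightarrow> (\<lambda>x. u x - v x) \<in> dom_of R"
  using dom_lincomb[of u v 1 "-1"] by simp

lemma dom_const: "restr (\<lambda>_. c) X \<in> dom_of R"
  using rf by (auto simp: resistance_form_def)

lemma dom_zero: "(\<lambda>x. 0) \<in> dom_of R"
  using dom_lincomb[OF dom_const dom_const, of 0 0 0 0] by simp

lemma energy_sym: "u \<in> dom_of R \<Longrightarrow> v \<in> dom_of R \<Longrightarrow> energy R u v = energy R v u"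
  using rf by (auto simp: resistance_form_def)

lemma energy_lincomb_left:
  "u \<in> dom_of R \<Longrightarrow> v \<in> dom_of R \<Longrightarrow> w \<in> dom_of R \<Longrightarrow>
    energy R (\<lambda>x. a * u x + b * v x) w = a * energy R u w + b * energy R v w"
  using rf by (auto simp: resistance_form_def)

lemma energy_nonneg: "u \<in> dom_of R \<Longrightarrow> 0 \<le> energy R u u"
  using rf by (auto simp: resistance_form_def)

lemma energy_eq_0_iff: "u \<in> dom_of R \<Longrightarrow> energy R u u = 0 \<longleftrightarrow> (\<exists>c. \<forall>x\<in>X. u x = c)"
  using rf by (auto simp: resistance_form_def)

lemma energy_complete:
  assumes "\<And>n. u n \<in> dom_of R"
    and "\<And>e. e > 0 \<Longrightarrow>
      \<exists>N. \<forall>m\<ge>N. \<forall>n\<ge>N. energy R (\<lambda>x. u m x - u n x) (\<lambda>x. u m x - u n x) < e"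
  shows "\<exists>v\<in>dom_of R. (\<lambda>n. energy R (\<lambda>x. u n x - v x) (\<lambda>x. u n x - v x)) \<longlonglongrightarrow> 0"
proof -
  have "\<forall>u. (\<forall>n. u n \<in> dom_of R) \<and>
      (\<forall>e>0. \<exists>N. \<forall>m\<ge>N. \<forall>n\<ge>N. energy R (\<lambda>x. u m x - u n x) (\<lambda>x. u m x - u n x) < e) \<longrightarrow>
      (\<exists>v\<in>dom_of R. (\<lambda>n. energy R (\<lambda>x. u n x - v x) (\<lambda>x. u n x - v x)) \<longlonglongrightarrow> 0)"
    using rf unfolding resistance_form_def by (elim conjE)
  with assms show ?thesis by simp
qed

lemma interpolation:
  assumes "finite U" "U \<subseteq> X"
  shows "\<exists>u\<in>dom_of R. \<forall>x\<in>U. u x = f x"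
proof -
  have "\<forall>V v. finite V \<and> V \<subseteq> X \<longrightarrow> (\<exists>u\<in>dom_of R. \<forall>x\<in>V. u x = v x)"
    using rf unfolding resistance_form_def by (elim conjE)
  with assms show ?thesis by blast
qed

lemma energy_lincomb_right:
  "u \<in> dom_of R \<Longrightarrow> v \<in> dom_of R \<Longrightarrow> w \<in> dom_of R \<Longrightarrow>
    energy R w (\<lambda>x. a * u x + b * v x) = a * energy R w u + b * energy R w v"
  using energy_lincomb_left[of u v w a b] energy_sym dom_lincomb by metis

lemma energy_lincomb:
  "u \<in> dom_of R \<Longrightarrow> v \<in> dom_of R \<Longrightarrow>
    energy R (\<lambda>x. a * u x + b * v x) (\<lambda>x. a * u x + b * v x) =
      a\<^sup>2 * energy R u u + 2 * a * b * energy R u v + b\<^sup>2 * energy R v v"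
  by (simp add: energy_lincomb_left energy_lincomb_right dom_lincomb energy_sym[of v u]
      power2_eq_square algebra_simps)

lemma energy_diff_left:
  "u \<in> dom_of R \<Longrightarrow> v \<in> dom_of R \<Longrightarrow> w \<in> dom_of R \<Longrightarrow>
    energy R (\<lambda>x. u x - v x) w = energy R u w - energy R v w"
  using energy_lincomb_left[of u v w 1 "-1"] by simp

lemma energy_zero_left: "w \<in> dom_of R \<Longrightarrow> energy R (\<lambda>x. 0) w = 0"
  using energy_lincomb_left[OF dom_zero dom_zero, of w 0 0] by simp

lemma dom_sum:
  "finite I \<Longrightarrow> (\<And>i. i \<in> I \<Longrightarrow> u i \<in> dom_of R) \<Longrightarrow> (\<lambda>x. \<Sum>i\<in>I. a i * u i x) \<in> dom_of R"
proof (induction I rule: finite_induct)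
  case (insert i I)
  then have "(\<lambda>x. a i * u i x + 1 * (\<Sum>i\<in>I. a i * u i x)) \<in> dom_of R"
    by (intro dom_lincomb) auto
  with insert show ?case by simp
qed (simp add: dom_zero)

lemma energy_sum_left:
  "finite I \<Longrightarrow> (\<And>i. i \<in> I \<Longrightarrow> u i \<in> dom_of R) \<Longrightarrow> w \<in> dom_of R \<Longrightarrow>
    energy R (\<lambda>x. \<Sum>i\<in>I. a i * u i x) w = (\<Sum>i\<in>I. a i * energy R (u i) w)"
proof (induction I rule: finite_induct)
  case (insert i I)
  then have "energy R (\<lambda>x. a i * u i x + 1 * (\<Sum>i\<in>I. a i * u i x)) w =
      a i * energy R (u i) w + 1 * energy R (\<lambda>x. \<Sum>i\<in>I. a i * u i x) w"
    by (intro energy_lincomb_left dom_sum) auto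
  with insert show ?case by simp
qed (simp add: energy_zero_left)

lemma energy_Cauchy_Schwarz:
  assumes "u \<in> dom_of R" "v \<in> dom_of R"
  shows "(energy R u v)\<^sup>2 \<le> energy R u u * energy R v v"
proof (rule nonneg_quadratic_discriminant)
  show "0 \<le> energy R u u + 2 * t * energy R u v + t\<^sup>2 * energy R v v" for t
    using energy_nonneg[OF dom_lincomb[OF assms, of 1 t]] energy_lincomb[OF assms, of 1 t] by simp
qed (use assms energy_nonneg in auto)

lemma energy_const_left: "w \<in> dom_of R \<Longrightarrow> energy R (restr (\<lambda>_. c) X) w = 0"
proof -
  assume w: "w \<in> dom_of R"
  have "energy R (restr (\<lambda>_. c) X) (restr (\<lambda>_. c) X) = 0"
    unfolding energy_eq_0_iff[OF dom_const] by (auto simp: restr_def)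
  then show ?thesis using energy_Cauchy_Schwarz[OF dom_const w, of c] by simp
qed

text \<open>This carries convergence in energy over to convergence of differences of values.\<close>

lemma pointwise_bound:
  assumes "p \<in> X" "q \<in> X"
  shows "\<exists>C. \<forall>u\<in>dom_of R. (u p - u q)\<^sup>2 \<le> C * energy R u u"
proof -
  have "\<forall>p\<in>X. \<forall>q\<in>X.
      bdd_above {(u p - u q)\<^sup>2 / energy R u u | u. u \<in> dom_of R \<and> energy R u u > 0}"
    using rf unfolding resistance_form_def by (elim conjE)
  with assms have "bdd_above {(u p - u q)\<^sup>2 / energy R u u | u. u \<in> dom_of R \<and> energy R u u > 0}"
    by (elim ballE) auto
  then obtain C where C: "\<And>u. u \<in> dom_of R \<Longrightarrow> energy R u u > 0 \<Longrightarrow> (u p - u q)\<^sup>2 / energy R u u \<le> C"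
    unfolding bdd_above_def by blast
  have "(u p - u q)\<^sup>2 \<le> C * energy R u u" if u: "u \<in> dom_of R" for u
  proof (cases "energy R u u = 0")
    case True
    then have "u p = u q" using energy_eq_0_iff[OF u] assms by auto
    with True show ?thesis by simp
  next
    case False
    with energy_nonneg[OF u] have "energy R u u > 0" by simp
    with C[OF u] show ?thesis by (simp add: field_simps)
  qed
  then show ?thesis by blast
qed

lemma harmonic_off_iff_minimizer:
  assumes g: "g \<in> dom_of R"
  shows "harmonic_off R U g \<longleftrightarrow>
    (\<forall>g'\<in>dom_of R. (\<forall>x\<in>U. g' x = g x) \<longrightarrow> energy R g g \<le> energy R g' g')"
proof (intro iffI ballI impI)
  fix g' assume "harmonic_off R U g" and g': "g' \<in> dom_of R" "\<forall>x\<in>U. g' x = g x"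
  then have w: "(\<lambda>x. g' x - g x) \<in> dom_of R" "energy R g (\<lambda>x. g' x - g x) = 0"
    using g by (auto simp: harmonic_off_def dom_diff)
  have "energy R g' g' = energy R g g + energy R (\<lambda>x. g' x - g x) (\<lambda>x. g' x - g x)"
    using energy_lincomb[OF g w(1), of 1 1] w(2) by simp
  then show "energy R g g \<le> energy R g' g'" using energy_nonneg[OF w(1)] by simp
next
  assume min: "\<forall>g'\<in>dom_of R. (\<forall>x\<in>U. g' x = g x) \<longrightarrow> energy R g g \<le> energy R g' g'"
  have "energy R g w = 0" if w: "w \<in> dom_of R" "\<forall>x\<in>U. w x = 0" for w
  proof -
    have "(energy R g w)\<^sup>2 \<le> 0 * energy R w w"
    proof (rule nonneg_quadratic_discriminant)
      fix t
      have "energy R g g \<le> energy R (\<lambda>x. 1 * g x + t * w x) (\<lambda>x. 1 * g x + t * w x)"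
        using min w dom_lincomb[OF g w(1), of 1 t] by simp
      then show "0 \<le> 0 + 2 * t * energy R g w + t\<^sup>2 * energy R w w"
        unfolding energy_lincomb[OF g w(1)] by simp
    qed (use w energy_nonneg in auto)
    then show ?thesis by simp
  qed
  with g show "harmonic_off R U g" by (auto simp: harmonic_off_def)
qed

lemma harmonic_off_unique:
  assumes U: "U \<subseteq> X" "U \<noteq> {}" and g: "harmonic_off R U g" and g': "harmonic_off R U g'"
    and eq: "\<forall>x\<in>U. g x = g' x"
  shows "g = g'"
proof -
  have dom: "g \<in> dom_of R" "g' \<in> dom_of R" using g g' by (auto simp: harmonic_off_def)
  define d where "d x = g x - g' x" for x
  have d: "d \<in> dom_of R" "\<forall>x\<in>U. d x = 0"
    using dom_diff[OF dom] eq by (auto simp: d_def[abs_def])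
  have "energy R d d = energy R g d - energy R g' d"
    using energy_diff_left[OF dom d(1)] by (simp add: d_def[abs_def])
  also have "\<dots> = 0" using g g' d by (simp add: harmonic_off_def)
  finally obtain c where c: "\<forall>x\<in>X. d x = c" using energy_eq_0_iff[OF d(1)] by auto
  with U d(2) have "c = 0" by auto
  with c have "\<forall>x\<in>X. g x = g' x" by (simp add: d_def)
  moreover have "\<forall>x. x \<notin> X \<longrightarrow> g x = g' x" using dom[THEN dom_ell] by (auto simp: ell_def)
  ultimately show ?thesis by (intro ext) blast
qed

lemma harmonic_off_lincomb:
  "harmonic_off R U u \<Longrightarrow> harmonic_off R U v \<Longrightarrow> harmonic_off R U (\<lambda>x. a * u x + b * v x)"
  by (auto simp: harmonic_off_def dom_lincomb energy_lincomb_left)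

text \<open>The direct method. The parallelogram identity makes a minimizing sequence Cauchy, but completeness
  yields a limit in energy only, hence up to a constant. The differences of its values are
  right by \<open>pointwise_bound\<close>; the constant is then adjusted at one point of \<open>U\<close>.\<close>

lemma harmonic_off_exists:
  assumes U: "finite U" "U \<subseteq> X" "U \<noteq> {}"
  shows "\<exists>g. harmonic_off R U g \<and> (\<forall>x\<in>U. g x = f x)"
proof -
  define A where "A = {g \<in> dom_of R. \<forall>x\<in>U. g x = f x}"
  define m where "m = (INF g\<in>A. energy R g g)"
  have "A \<noteq> {}" using interpolation[OF U(1,2), of f] by (auto simp: A_def)
  have bdd: "bdd_below ((\<lambda>g. energy R g g) ` A)"
    by (rule bdd_belowI2[of _ 0]) (auto simp: A_def energy_nonneg)
  have m_le: "m \<le> energy R g g" if "g \<in> A" for g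
    unfolding m_def by (rule cINF_lower[OF bdd that])
  have "\<exists>g\<in>A. energy R g g < m + 1 / Suc n" for n
    unfolding m_def using cINF_less_iff[OF \<open>A \<noteq> {}\<close> bdd, THEN iffD1] by simp
  then obtain u where u: "\<And>n. u n \<in> A" and um: "\<And>n. energy R (u n) (u n) < m + 1 / Suc n"
    by metis
  have ud: "u n \<in> dom_of R" for n using u by (auto simp: A_def)
  \<comment> \<open>The first variation at a function that is almost minimal is almost zero.\<close>
  have almost_orthogonal: "(energy R (u n) w)\<^sup>2 \<le> 1 / Suc n * energy R w w"
    if w: "w \<in> dom_of R" "\<forall>x\<in>U. w x = 0" for w n
  proof (rule nonneg_quadratic_discriminant)
    fix t
    have "(\<lambda>x. 1 * u n x + t * w x) \<in> A"
      using u[of n] w dom_lincomb[OF ud w(1), of 1 n t] by (simp add: A_def)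
    from m_le[OF this] um[of n]
    show "0 \<le> 1 / Suc n + 2 * t * energy R (u n) w + t\<^sup>2 * energy R w w"
      unfolding energy_lincomb[OF ud w(1)] by simp
  qed (use w energy_nonneg in auto)
  \<comment> \<open>The midpoint of two members of \<open>A\<close> lies in \<open>A\<close>, so its energy is at least \<open>m\<close>.\<close>
  have diff_small: "energy R (\<lambda>x. u k x - u n x) (\<lambda>x. u k x - u n x) \<le> 2 * (1 / Suc k) + 2 * (1 / Suc n)" for k n
  proof -
    have "(\<lambda>x. 1/2 * u k x + 1/2 * u n x) \<in> A"
      using u[of k] u[of n] dom_lincomb[OF ud[of k] ud[of n], of "1/2" "1/2"] by (simp add: A_def)
    from m_le[OF this]
    have "4 * m \<le> energy R (u k) (u k) + 2 * energy R (u k) (u n) + energy R (u n) (u n)"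
      unfolding energy_lincomb[OF ud ud] by (simp add: power2_eq_square)
    moreover have "energy R (\<lambda>x. u k x - u n x) (\<lambda>x. u k x - u n x) =
        energy R (u k) (u k) - 2 * energy R (u k) (u n) + energy R (u n) (u n)"
      using energy_lincomb[OF ud[of k] ud[of n], of 1 "-1"] by simp
    ultimately show ?thesis using um[of k] um[of n] by simp
  qed
  have cauchy: "\<exists>N. \<forall>k\<ge>N. \<forall>n\<ge>N. energy R (\<lambda>x. u k x - u n x) (\<lambda>x. u k x - u n x) < e"
    if e: "e > 0" for e
  proof -
    have "0 < e / 4" using e by simp
    then obtain N where N: "1 / Suc N < e / 4" by (rule nat_approx_posE)
    have small: "1 / Suc k < e / 4" if "k \<ge> N" for k
      using N that by (intro le_less_trans[OF _ N]) (auto simp: field_simps)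
    then have "energy R (\<lambda>x. u k x - u n x) (\<lambda>x. u k x - u n x) < e" if "k \<ge> N" "n \<ge> N" for k n
      using diff_small[of k n] small[OF that(1)] small[OF that(2)] by linarith
    then show ?thesis by blast
  qed
  obtain v where v: "v \<in> dom_of R"
    and lim: "(\<lambda>n. energy R (\<lambda>x. u n x - v x) (\<lambda>x. u n x - v x)) \<longlonglongrightarrow> 0"
    using energy_complete[OF ud cauchy] by blast
  have inv_lim: "(\<lambda>n. 1 / real (Suc n)) \<longlonglongrightarrow> 0"
    using LIMSEQ_inverse_real_of_nat by (simp add: inverse_eq_divide)
  have orth: "energy R v w = 0" if w: "w \<in> dom_of R" "\<forall>x\<in>U. w x = 0" for w
  proof -
    have "(energy R v w)\<^sup>2 \<le> 2 * (1 / Suc n * energy R w w) +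
        2 * (energy R (\<lambda>x. u n x - v x) (\<lambda>x. u n x - v x) * energy R w w)" for n
    proof -
      define a b where "a = energy R (u n) w" and "b = energy R (\<lambda>x. u n x - v x) w"
      have "energy R v w = a - b"
        using energy_diff_left[OF ud v w(1)] by (simp add: a_def b_def)
      moreover have "(a - b)\<^sup>2 \<le> 2 * a\<^sup>2 + 2 * b\<^sup>2"
        using zero_le_power2[of "a + b"] by (simp add: power2_eq_square algebra_simps)
      moreover have "a\<^sup>2 \<le> 1 / Suc n * energy R w w"
        unfolding a_def by (rule almost_orthogonal[OF w])
      moreover have "b\<^sup>2 \<le> energy R (\<lambda>x. u n x - v x) (\<lambda>x. u n x - v x) * energy R w w"
        unfolding b_def by (rule energy_Cauchy_Schwarz[OF dom_diff[OF ud v] w(1)])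
      ultimately show ?thesis by simp
    qed
    moreover have "(\<lambda>n. 2 * (1 / Suc n * energy R w w) +
        2 * (energy R (\<lambda>x. u n x - v x) (\<lambda>x. u n x - v x) * energy R w w)) \<longlonglongrightarrow>
        2 * (0 * energy R w w) + 2 * (0 * energy R w w)"
      by (intro tendsto_intros inv_lim lim)
    ultimately have "(energy R v w)\<^sup>2 \<le> 2 * (0 * energy R w w) + 2 * (0 * energy R w w)"
      by (intro LIMSEQ_le_const) auto
    then show ?thesis by simp
  qed
  obtain p0 where p0: "p0 \<in> U" using U(3) by auto
  define c where "c = f p0 - v p0"
  have interp: "v p + c = f p" if p: "p \<in> U" for p
  proof -
    obtain C where C: "\<And>w. w \<in> dom_of R \<Longrightarrow> (w p - w p0)\<^sup>2 \<le> C * energy R w w"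
      using pointwise_bound[of p p0] p p0 U(2) by blast
    have "(f p - v p - c)\<^sup>2 \<le> C * energy R (\<lambda>x. u n x - v x) (\<lambda>x. u n x - v x)" for n
      using C[OF dom_diff[OF ud v], of n] u[of n] p p0 by (simp add: A_def c_def)
    moreover have "(\<lambda>n. C * energy R (\<lambda>x. u n x - v x) (\<lambda>x. u n x - v x)) \<longlonglongrightarrow> C * 0"
      by (intro tendsto_intros lim)
    ultimately have "(f p - v p - c)\<^sup>2 \<le> C * 0" by (intro LIMSEQ_le_const) auto
    then show ?thesis by simp
  qed
  define g where "g = (\<lambda>x. 1 * v x + 1 * restr (\<lambda>_. c) X x)"
  have "harmonic_off R U g"
    unfolding g_def
    by (rule harmonic_off_lincomb)
       (use v orth energy_const_left in \<open>auto simp: harmonic_off_def dom_const\<close>)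
  moreover have "\<forall>x\<in>U. g x = f x"
    using interp U(2) by (auto simp: g_def restr_def)
  ultimately show ?thesis by blast
qed

lemma trace_form_eq_energy:
  assumes g: "harmonic_off R U g" and eq: "\<forall>x\<in>U. g x = f x"
  shows "trace_form R U f = energy R g g"
  unfolding trace_form_def
proof (rule Least_equality)
  have dom: "g \<in> dom_of R" using g by (simp add: harmonic_off_def)
  then show "\<exists>g'\<in>dom_of R. (\<forall>x\<in>U. g' x = f x) \<and> energy R g g = energy R g' g'"
    using eq by blast
  fix e assume "\<exists>g'\<in>dom_of R. (\<forall>x\<in>U. g' x = f x) \<and> e = energy R g' g'"
  then show "energy R g g \<le> e" using harmonic_off_iff_minimizer[OF dom] g eq by auto
qed

text \<open>The minimizer with values \<open>f\<close> is the combination, with coefficients \<open>f p\<close>, of the minimizers for the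
  indicators of the points \<open>p\<close>, so the matrix is the Gram matrix of the latter.\<close>

lemma trace_form_matrix:
  assumes U: "finite U" "U \<subseteq> X" "U \<noteq> {}"
  shows "\<exists>D. (\<forall>s t. D s t = D t s) \<and> (\<forall>s t. s \<notin> U \<or> t \<notin> U \<longrightarrow> D s t = 0) \<and>
     (\<forall>f. trace_form R U f = (\<Sum>s\<in>U. f s * (\<Sum>t\<in>U. D s t * f t)))"
proof -
  have "\<exists>g. harmonic_off R U g \<and> (\<forall>x\<in>U. g x = indicator {p} x)" for p
    by (rule harmonic_off_exists[OF U])
  then obtain H where H: "\<And>p. harmonic_off R U (H p)" "\<And>p x. x \<in> U \<Longrightarrow> H p x = indicator {p} x"
    by metis
  have Hd: "H p \<in> dom_of R" for p using H(1) by (simp add: harmonic_off_def)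
  define D where "D s t = (if s \<in> U \<and> t \<in> U then energy R (H s) (H t) else 0)" for s t
  have "trace_form R U f = (\<Sum>s\<in>U. f s * (\<Sum>t\<in>U. D s t * f t))" for f
  proof -
    define g where "g = (\<lambda>x. \<Sum>p\<in>U. f p * H p x)"
    have gd: "g \<in> dom_of R" unfolding g_def by (rule dom_sum[OF U(1) Hd])
    have gw: "energy R g w = (\<Sum>p\<in>U. f p * energy R (H p) w)" if "w \<in> dom_of R" for w
      unfolding g_def by (rule energy_sum_left[OF U(1) Hd that])
    have "harmonic_off R U g"
      using H(1) gw gd by (auto simp: harmonic_off_def)
    moreover have "g x = f x" if "x \<in> U" for x
    proof -
      have "g x = (\<Sum>p\<in>U. if p = x then f p else 0)"
        unfolding g_def using that H(2) by (intro sum.cong) (auto simp: indicator_def)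
      then show ?thesis using U(1) that by simp
    qed
    ultimately have "trace_form R U f = energy R g g" by (intro trace_form_eq_energy) auto
    also have "\<dots> = (\<Sum>s\<in>U. f s * energy R (H s) g)" by (rule gw[OF gd])
    also have "\<dots> = (\<Sum>s\<in>U. f s * (\<Sum>t\<in>U. D s t * f t))"
    proof (intro sum.cong refl arg_cong2[where f = "(*)"])
      fix s assume "s \<in> U"
      have "energy R (H s) g = energy R g (H s)" by (rule energy_sym[OF Hd gd])
      also have "\<dots> = (\<Sum>t\<in>U. D s t * f t)"
        unfolding gw[OF Hd] using \<open>s \<in> U\<close> energy_sym[OF Hd Hd]
        by (intro sum.cong) (auto simp: D_def)
      finally show "energy R (H s) g = (\<Sum>t\<in>U. D s t * f t)" .
    qed
    finally show ?thesis .
  qed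
  moreover have "D s t = D t s" for s t using energy_sym[OF Hd Hd] by (simp add: D_def)
  moreover have "D s t = 0" if "s \<notin> U \<or> t \<notin> U" for s t using that by (auto simp: D_def)
  ultimately show ?thesis by blast
qed

end

lemma symmetric_matrix_polarization:
  fixes D :: "'a \<Rightarrow> 'a \<Rightarrow> real"
  assumes sym: "\<And>s t. D s t = D t s"
    and T: "\<And>f. T f = (\<Sum>s\<in>U. f s * (\<Sum>t\<in>U. D s t * f t))"
  shows "(\<Sum>s\<in>U. \<Sum>t\<in>U. f s * D s t * g t) = (T (\<lambda>x. f x + g x) - T f - T g) / 2"
proof -
  define B where "B f g = (\<Sum>s\<in>U. \<Sum>t\<in>U. f s * D s t * g t)" for f g :: "'a \<Rightarrow> real"
  have "B g f = B f g"
  proof -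
    have "B g f = (\<Sum>t\<in>U. \<Sum>s\<in>U. g s * D s t * f t)"
      unfolding B_def by (rule sum.swap)
    also have "\<dots> = (\<Sum>t\<in>U. \<Sum>s\<in>U. f t * D t s * g s)"
      by (intro sum.cong refl) (subst sym, simp add: mult_ac)
    finally show ?thesis by (simp add: B_def)
  qed
  moreover have "T f = B f f" for f by (simp add: T B_def sum_distrib_left mult_ac)
  moreover have "B (\<lambda>x. f x + g x) (\<lambda>x. f x + g x) = B f f + B f g + B g f + B g g"
    by (simp add: B_def distrib_left distrib_right sum.distrib)
  ultimately show ?thesis by (simp add: B_def)
qed

text \<open>The entries are recovered from the quadratic form by polarization at pairs of indicators.\<close>

lemma symmetric_matrix_unique:
  fixes D D' :: "'a \<Rightarrow> 'a \<Rightarrow> real"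
  assumes "finite U"
    and D: "\<And>s t. D s t = D t s" "\<And>s t. s \<notin> U \<or> t \<notin> U \<Longrightarrow> D s t = 0"
      "\<And>f. T f = (\<Sum>s\<in>U. f s * (\<Sum>t\<in>U. D s t * f t))"
    and D': "\<And>s t. D' s t = D' t s" "\<And>s t. s \<notin> U \<or> t \<notin> U \<Longrightarrow> D' s t = 0"
      "\<And>f. T f = (\<Sum>s\<in>U. f s * (\<Sum>t\<in>U. D' s t * f t))"
  shows "D = D'"
proof (intro ext)
  fix s t
  have entry: "(\<Sum>x\<in>U. \<Sum>y\<in>U. indicator {s} x * A x y * indicator {t} y) = A s t"
    if "s \<in> U" "t \<in> U" for A :: "'a \<Rightarrow> 'a \<Rightarrow> real"
  proof -
    have "(\<Sum>x\<in>U. \<Sum>y\<in>U. indicator {s} x * A x y * indicator {t} y) =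
        (\<Sum>x\<in>U. \<Sum>y\<in>U. if y = t then (if x = s then A x t else 0) else 0)"
      by (intro sum.cong refl) (auto simp: indicator_def)
    also have "\<dots> = A s t" using that \<open>finite U\<close> by simp
    finally show ?thesis .
  qed
  show "D s t = D' s t"
  proof (cases "s \<in> U \<and> t \<in> U")
    case True
    then show ?thesis
      using symmetric_matrix_polarization[OF D(1,3), of "indicator {s}" "indicator {t}"]
        symmetric_matrix_polarization[OF D'(1,3), of "indicator {s}" "indicator {t}"]
        entry[of D] entry[of D'] by simp
  next
    case False
    then show ?thesis using D(2) D'(2) by metis
  qed
qed

section \<open>The cells of a finitely ramified fractal\<close>

locale ramified_fractal =
  fixes K :: "('i, 'a::metric_space) fractal"
  assumes fractal: "finitely_ramified_fractal K"
begin

lemma indices_eq: "indices K = (\<Union>n. level K n)"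
  using fractal unfolding finitely_ramified_fractal_def by (elim conjE)

lemma level_indices: "\<alpha> \<in> level K n \<Longrightarrow> \<alpha> \<in> indices K"
  by (auto simp: indices_eq)

lemma indices_level: "\<alpha> \<in> indices K \<Longrightarrow> \<exists>n. \<alpha> \<in> level K n"
  by (auto simp: indices_eq)

lemma finite_level: "finite (level K n)"
proof -
  have "\<forall>n. finite (level K n)"
    using fractal unfolding finitely_ramified_fractal_def by (elim conjE)
  then show ?thesis ..
qed

lemma level_0: "level K 0 = {top_ix K}"
  using fractal unfolding finitely_ramified_fractal_def by (elim conjE)

lemma cell_top: "cell K (top_ix K) = space_F K"
  using fractal unfolding finitely_ramified_fractal_def by (elim conjE)

lemma cell_props:
  assumes "\<alpha> \<in> indices K"
  shows "compact (cell K \<alpha>)" "connected (cell K \<alpha>)" "cell K \<alpha> \<subseteq> space_F K"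
proof -
  have "\<forall>\<alpha>\<in>indices K. compact (cell K \<alpha>) \<and> connected (cell K \<alpha>) \<and> cell K \<alpha> \<subseteq> space_F K"
    using fractal unfolding finitely_ramified_fractal_def by (elim conjE)
  with assms show "compact (cell K \<alpha>)" "connected (cell K \<alpha>)" "cell K \<alpha> \<subseteq> space_F K" by auto
qed

lemma vert_props:
  assumes "\<alpha> \<in> indices K"
  shows "finite (vert K \<alpha>)" "vert K \<alpha> \<subseteq> cell K \<alpha>" "card (vert K \<alpha>) \<ge> 2"
proof -
  have "\<forall>\<alpha>\<in>indices K. finite (vert K \<alpha>) \<and> vert K \<alpha> \<subseteq> cell K \<alpha> \<and> card (vert K \<alpha>) \<ge> 2"
    using fractal unfolding finitely_ramified_fractal_def by (elim conjE)
  with assms show "finite (vert K \<alpha>)" "vert K \<alpha> \<subseteq> cell K \<alpha>" "card (vert K \<alpha>) \<ge> 2" by auto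
qed

lemma vert_nonempty: "\<alpha> \<in> indices K \<Longrightarrow> vert K \<alpha> \<noteq> {}"
  using vert_props(3)[of \<alpha>] by auto

lemma cells_meet_in_vertices:
  assumes "\<alpha> \<in> level K n" "\<beta> \<in> level K n" "\<alpha> \<noteq> \<beta>"
  shows "cell K \<alpha> \<inter> cell K \<beta> = vert K \<alpha> \<inter> vert K \<beta>"
proof -
  have "\<forall>n. \<forall>\<alpha>\<in>level K n. \<forall>\<beta>\<in>level K n. \<alpha> \<noteq> \<beta> \<longrightarrow>
      cell K \<alpha> \<inter> cell K \<beta> = vert K \<alpha> \<inter> vert K \<beta>"
    using fractal unfolding finitely_ramified_fractal_def by (elim conjE)
  with assms show ?thesis by blast
qed

lemma refinement:
  assumes "\<alpha> \<in> level K n"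
  obtains J where "J \<subseteq> level K (Suc n)" "finite J" "cell K \<alpha> = (\<Union>\<beta>\<in>J. cell K \<beta>)"
    "vert K \<alpha> \<subseteq> (\<Union>\<beta>\<in>J. vert K \<beta>)"
proof -
  have "\<forall>n. \<forall>\<alpha>\<in>level K n. \<exists>J. J \<subseteq> level K (Suc n) \<and> finite J \<and> cell K \<alpha> = (\<Union>\<beta>\<in>J. cell K \<beta>)"
    using fractal unfolding finitely_ramified_fractal_def by (elim conjE)
  from bspec[OF spec[OF this] assms]
  obtain J where J: "J \<subseteq> level K (Suc n)" "finite J" "cell K \<alpha> = (\<Union>\<beta>\<in>J. cell K \<beta>)"
    by blast
  have "\<forall>\<alpha>\<in>indices K. \<forall>J. J \<subseteq> indices K \<and> finite J \<and> cell K \<alpha> = (\<Union>\<beta>\<in>J. cell K \<beta>)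
        \<longrightarrow> vert K \<alpha> \<subseteq> (\<Union>\<beta>\<in>J. vert K \<beta>)"
    using fractal unfolding finitely_ramified_fractal_def by (elim conjE)
  from spec[OF bspec[OF this level_indices[OF assms]], of J]
  have "vert K \<alpha> \<subseteq> (\<Union>\<beta>\<in>J. vert K \<beta>)"
    using J level_indices by auto
  with J show thesis by (rule that)
qed

text \<open>A finite connected set has at most one point, while a cell has two vertices. This is what makes a
  cell different from the finite overlaps of other cells, and hence what makes parents exist and be unique.\<close>

lemma cell_infinite:
  assumes "\<alpha> \<in> indices K"
  shows "infinite (cell K \<alpha>)"
proof
  assume fin: "finite (cell K \<alpha>)"
  then have "cell K \<alpha> = {} \<or> (\<exists>x. cell K \<alpha> = {x})"
    using connected_finite_iff_sing[OF cell_props(2)[OF assms]] by blast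
  then have "card (cell K \<alpha>) \<le> 1" by auto
  moreover have "card (vert K \<alpha>) \<le> card (cell K \<alpha>)"
    using fin vert_props(2)[OF assms] by (rule card_mono)
  ultimately show False using vert_props(3)[OF assms] by simp
qed

lemma subcell_through_point:
  assumes "\<alpha> \<in> level K n" "x \<in> cell K \<alpha>"
  shows "\<exists>\<beta>\<in>level K (Suc n). x \<in> cell K \<beta> \<and> cell K \<beta> \<subseteq> cell K \<alpha>"
proof -
  obtain J where J: "J \<subseteq> level K (Suc n)" "cell K \<alpha> = (\<Union>\<beta>\<in>J. cell K \<beta>)"
    using refinement[OF assms(1)] by metis
  then obtain \<beta> where "\<beta> \<in> J" "x \<in> cell K \<beta>" using assms(2) by auto
  with J show ?thesis by auto
qed

lemma cells_cover: "space_F K = (\<Union>\<alpha>\<in>level K n. cell K \<alpha>)"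
proof (rule antisym)
  show "(\<Union>\<alpha>\<in>level K n. cell K \<alpha>) \<subseteq> space_F K"
    using cell_props(3) level_indices by blast
  show "space_F K \<subseteq> (\<Union>\<alpha>\<in>level K n. cell K \<alpha>)"
  proof (induction n)
    case 0 show ?case by (simp add: level_0 cell_top)
  next
    case (Suc n)
    then show ?case using subcell_through_point by blast
  qed
qed

text \<open>A cell contained in no cell of the previous level would be covered by other cells of its own level,
  which it meets only in its vertices.\<close>

lemma parent_exists:
  assumes \<beta>: "\<beta> \<in> level K (Suc n)"
  shows "\<exists>\<alpha>\<in>level K n. cell K \<beta> \<subseteq> cell K \<alpha>"
proof (rule ccontr)
  assume orphan: "\<not> (\<exists>\<alpha>\<in>level K n. cell K \<beta> \<subseteq> cell K \<alpha>)"
  have "cell K \<beta> \<subseteq> vert K \<beta>"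
  proof
    fix x assume x: "x \<in> cell K \<beta>"
    then have "x \<in> space_F K" using cell_props(3)[OF level_indices[OF \<beta>]] by blast
    then obtain \<alpha> where \<alpha>: "\<alpha> \<in> level K n" "x \<in> cell K \<alpha>" using cells_cover by blast
    then obtain \<gamma> where \<gamma>: "\<gamma> \<in> level K (Suc n)" "x \<in> cell K \<gamma>" "cell K \<gamma> \<subseteq> cell K \<alpha>"
      using subcell_through_point by blast
    then have "\<gamma> \<noteq> \<beta>" using orphan \<alpha>(1) by blast
    then show "x \<in> vert K \<beta>" using cells_meet_in_vertices[OF \<beta> \<gamma>(1)] x \<gamma>(2) by blast
  qed
  then have "finite (cell K \<beta>)"
    by (rule finite_subset) (rule vert_props(1)[OF level_indices[OF \<beta>]])
  then show False using cell_infinite[OF level_indices[OF \<beta>]] by blast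
qed

lemma parent_unique:
  assumes \<alpha>: "\<alpha> \<in> level K n" "\<alpha>' \<in> level K n" and \<beta>: "\<beta> \<in> indices K"
    and sub: "cell K \<beta> \<subseteq> cell K \<alpha>" "cell K \<beta> \<subseteq> cell K \<alpha>'"
  shows "\<alpha> = \<alpha>'"
proof (rule ccontr)
  assume "\<alpha> \<noteq> \<alpha>'"
  then have "cell K \<beta> \<subseteq> vert K \<alpha>" using cells_meet_in_vertices[OF \<alpha>] sub by blast
  then have "finite (cell K \<beta>)"
    by (rule finite_subset) (rule vert_props(1)[OF level_indices[OF \<alpha>(1)]])
  then show False using cell_infinite[OF \<beta>] by blast
qed

lemma V_level_0_subset: "V_level K 0 \<subseteq> V_level K n"
proof (induction n)
  case (Suc n)
  have "vert K \<alpha> \<subseteq> V_level K (Suc n)" if "\<alpha> \<in> level K n" for \<alpha>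
    by (rule refinement[OF that]) (unfold V_level_def, blast)
  then have "V_level K n \<subseteq> V_level K (Suc n)" by (auto simp: V_level_def)
  with Suc show ?case by blast
qed simp

text \<open>Needed for gluing: a function that lives on one cell and vanishes at the vertices of that cell does not
  change the values on the boundary \<open>V_0\<close>.\<close>

lemma boundary_Int_cell:
  assumes "x \<in> V_level K 0" "x \<in> cell K \<alpha>" and \<alpha>: "\<alpha> \<in> level K n"
  shows "x \<in> vert K \<alpha>"
proof -
  obtain \<beta> where \<beta>: "\<beta> \<in> level K n" "x \<in> vert K \<beta>"
    using V_level_0_subset[of n] assms(1) unfolding V_level_def by blast
  then have "x \<in> cell K \<beta>" using vert_props(2)[OF level_indices] by blast
  with \<beta> assms show ?thesis using cells_meet_in_vertices[OF \<alpha> \<beta>(1)] by (cases "\<alpha> = \<beta>") auto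
qed

lemma vert_subset_V_star: "\<alpha> \<in> indices K \<Longrightarrow> vert K \<alpha> \<subseteq> V_star K"
  using indices_level unfolding V_star_def V_level_def by blast

lemma V_level_0: "finite (V_level K 0)" "V_level K 0 \<noteq> {}" "V_level K 0 \<subseteq> V_star K"
proof -
  have top: "top_ix K \<in> indices K" using level_0 level_indices by blast
  have eq: "V_level K 0 = vert K (top_ix K)" by (simp add: V_level_def level_0)
  show "finite (V_level K 0)" "V_level K 0 \<noteq> {}" "V_level K 0 \<subseteq> V_star K"
    unfolding eq using top vert_props(1) vert_nonempty vert_subset_V_star by auto
qed

lemma countable_V_star: "countable (V_star K)"
proof -
  have "finite (V_level K n)" for n
    unfolding V_level_def using finite_level vert_props(1) level_indices by blast
  then show ?thesis unfolding V_star_def by (auto intro: countable_finite)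
qed

lemma V_star_subset: "V_star K \<subseteq> space_F K"
  unfolding V_star_def V_level_def using vert_props(2) cell_props(3) level_indices by blast

definition children :: "nat \<Rightarrow> 'i \<Rightarrow> 'i set" where
  "children n \<alpha> = {\<beta> \<in> level K (Suc n). cell K \<beta> \<subseteq> cell K \<alpha>}"

lemma sum_over_children:
  fixes f :: "'i \<Rightarrow> 'b::comm_monoid_add"
  shows "(\<Sum>\<beta>\<in>level K (Suc n). f \<beta>) = (\<Sum>\<alpha>\<in>level K n. \<Sum>\<beta>\<in>children n \<alpha>. f \<beta>)"
proof -
  have "level K (Suc n) = (\<Union>\<alpha>\<in>level K n. children n \<alpha>)"
    using parent_exists by (auto simp: children_def)
  moreover have "sum f (\<Union>\<alpha>\<in>level K n. children n \<alpha>) = (\<Sum>\<alpha>\<in>level K n. sum f (children n \<alpha>))"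
  proof (rule sum.UNION_disjoint)
    show "\<forall>\<alpha>\<in>level K n. finite (children n \<alpha>)" using finite_level by (simp add: children_def)
    show "\<forall>\<alpha>\<in>level K n. \<forall>\<alpha>'\<in>level K n. \<alpha> \<noteq> \<alpha>' \<longrightarrow> children n \<alpha> \<inter> children n \<alpha>' = {}"
      using parent_unique level_indices unfolding children_def by blast
  qed (rule finite_level)
  ultimately show ?thesis by simp
qed

end

section \<open>Harmonic functions and the energy on cells\<close>

locale fractal_form = ramified_fractal K
  for K :: "('i, 'a::metric_space) fractal" +
  fixes E :: "'a form" and Ec :: "'i \<Rightarrow> 'a form"
  assumes form: "resistance_form (V_star K) E"
    and splits: "splits_over_cells K E Ec"

sublocale fractal_form \<subseteq> resistance_space "V_star K" E
  by unfold_locales (rule form)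

context fractal_form
begin

abbreviation on_cell :: "'i \<Rightarrow> ('a \<Rightarrow> real) \<Rightarrow> 'a \<Rightarrow> real" where
  "on_cell \<alpha> u \<equiv> restr u (V_star K \<inter> cell K \<alpha>)"

definition cell_energy :: "'i \<Rightarrow> ('a \<Rightarrow> real) \<Rightarrow> real" where
  "cell_energy \<alpha> u = energy (Ec \<alpha>) (on_cell \<alpha> u) (on_cell \<alpha> u)"

lemma cell_space: "\<alpha> \<in> indices K \<Longrightarrow> resistance_space (V_star K \<inter> cell K \<alpha>) (Ec \<alpha>)"
  using splits by (simp add: splits_over_cells_def resistance_space_def)

lemma dom_iff:
  "f \<in> ell (V_star K) \<Longrightarrow> f \<in> dom_of E \<longleftrightarrow> (\<forall>\<alpha>\<in>level K n. on_cell \<alpha> f \<in> dom_of (Ec \<alpha>))"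
  using splits unfolding splits_over_cells_def by blast

lemma on_cell_dom: "f \<in> dom_of E \<Longrightarrow> \<alpha> \<in> indices K \<Longrightarrow> on_cell \<alpha> f \<in> dom_of (Ec \<alpha>)"
  using dom_iff dom_ell indices_level by blast

lemma energy_eq_sum: "f \<in> dom_of E \<Longrightarrow> energy E f f = (\<Sum>\<alpha>\<in>level K n. cell_energy \<alpha> f)"
  using splits dom_ell[of f] unfolding splits_over_cells_def cell_energy_def by blast

lemma cell_energy_nonneg: "u \<in> dom_of E \<Longrightarrow> \<alpha> \<in> indices K \<Longrightarrow> 0 \<le> cell_energy \<alpha> u"
  unfolding cell_energy_def by (intro resistance_space.energy_nonneg[OF cell_space] on_cell_dom)

lemma cell_energy_children:
  assumes u: "u \<in> dom_of E" and \<alpha>: "\<alpha> \<in> level K n"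
  shows "cell_energy \<alpha> u = (\<Sum>\<beta>\<in>children n \<alpha>. cell_energy \<beta> u)"
proof -
  have "\<forall>m n. m \<le> n \<longrightarrow> (\<forall>\<alpha>\<in>level K m. \<forall>f\<in>ell (V_star K \<inter> cell K \<alpha>).
        (f \<in> dom_of (Ec \<alpha>) \<longleftrightarrow>
           (\<forall>\<beta>\<in>{\<beta> \<in> level K n. cell K \<beta> \<subseteq> cell K \<alpha>}. on_cell \<beta> f \<in> dom_of (Ec \<beta>))) \<and>
        (f \<in> dom_of (Ec \<alpha>) \<longrightarrow>
           energy (Ec \<alpha>) f f = (\<Sum>\<beta>\<in>{\<beta> \<in> level K n. cell K \<beta> \<subseteq> cell K \<alpha>}.
             energy (Ec \<beta>) (on_cell \<beta> f) (on_cell \<beta> f))))"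
    using splits unfolding splits_over_cells_def by (elim conjE)
  then have split: "energy (Ec \<alpha>) f f =
      (\<Sum>\<beta>\<in>children n \<alpha>. energy (Ec \<beta>) (on_cell \<beta> f) (on_cell \<beta> f))"
    if "f \<in> ell (V_star K \<inter> cell K \<alpha>)" "f \<in> dom_of (Ec \<alpha>)" for f
    using that \<alpha> le_SucI[OF order_refl] unfolding children_def by blast
  have "cell_energy \<alpha> u = (\<Sum>\<beta>\<in>children n \<alpha>.
      energy (Ec \<beta>) (on_cell \<beta> (on_cell \<alpha> u)) (on_cell \<beta> (on_cell \<alpha> u)))"
    unfolding cell_energy_def
    by (intro split on_cell_dom u level_indices[OF \<alpha>]) (simp add: ell_def restr_def)
  also have "\<dots> = (\<Sum>\<beta>\<in>children n \<alpha>. cell_energy \<beta> u)"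
  proof (intro sum.cong refl)
    fix \<beta> assume "\<beta> \<in> children n \<alpha>"
    then have "on_cell \<beta> (on_cell \<alpha> u) = on_cell \<beta> u"
      by (auto simp: children_def restr_def fun_eq_iff)
    then show "energy (Ec \<beta>) (on_cell \<beta> (on_cell \<alpha> u)) (on_cell \<beta> (on_cell \<alpha> u)) = cell_energy \<beta> u"
      by (simp add: cell_energy_def)
  qed
  finally show ?thesis .
qed

lemma harmonic_iff_off: "harmonic K E u \<longleftrightarrow> harmonic_off E (V_level K 0) u"
  using harmonic_off_iff_minimizer[of u "V_level K 0"]
  by (auto simp: harmonic_def harmonic_off_def)

lemma harmonic_dom: "harmonic K E u \<Longrightarrow> u \<in> dom_of E"
  by (simp add: harmonic_def)

lemma harmonic_add: "harmonic K E u \<Longrightarrow> harmonic K E v \<Longrightarrow> harmonic K E (\<lambda>x. u x + v x)"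
  unfolding harmonic_iff_off using harmonic_off_lincomb[of _ u v 1 1] by simp

lemma harmonic_ext_harmonic: "harmonic K E (harmonic_ext K E f)"
proof -
  have "\<exists>!u. harmonic K E u \<and> (\<forall>x\<in>V_level K 0. u x = f x)"
    unfolding harmonic_iff_off
    using harmonic_off_exists[OF V_level_0(1,3,2), of f]
      harmonic_off_unique[OF V_level_0(3,2)] by metis
  from theI'[OF this] show ?thesis unfolding harmonic_ext_def by blast
qed

text \<open>A test function \<open>w\<close> on the cell that vanishes at its vertices, extended by zero, is a test function for
  \<open>u\<close> on the whole space. The splitting is assumed for the diagonal of the forms only, so the
  orthogonality of \<open>u\<close> and \<open>w\<close> on the cell is read off from the energies of \<open>u\<close>,
  \<open>w\<close> and \<open>u + w\<close>.\<close>

lemma harmonic_on_cell: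
  assumes u: "harmonic K E u" and \<alpha>: "\<alpha> \<in> indices K"
  shows "harmonic_off (Ec \<alpha>) (vert K \<alpha>) (on_cell \<alpha> u)"
proof -
  interpret C: resistance_space "V_star K \<inter> cell K \<alpha>" "Ec \<alpha>" by (rule cell_space[OF \<alpha>])
  obtain n where n: "\<alpha> \<in> level K n" using indices_level[OF \<alpha>] by blast
  have ud: "u \<in> dom_of E" using u by (simp add: harmonic_def)
  note ucd = on_cell_dom[OF ud \<alpha>]
  have "energy (Ec \<alpha>) (on_cell \<alpha> u) w = 0" if w: "w \<in> dom_of (Ec \<alpha>)" "\<forall>x\<in>vert K \<alpha>. w x = 0" for w
  proof -
    have w_out: "w x = 0" if "x \<notin> V_star K \<inter> cell K \<alpha>" for x
      using C.dom_ell[OF w(1)] that unfolding ell_def by blast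
    have w_self: "on_cell \<alpha> w = w" using w_out by (auto simp: restr_def fun_eq_iff)
    have w_other: "on_cell \<beta> w = (\<lambda>x. 0)" if "\<beta> \<in> level K n" "\<beta> \<noteq> \<alpha>" for \<beta>
      using cells_meet_in_vertices[OF n that(1)] that(2) w(2) w_out
      by (auto simp: restr_def fun_eq_iff)
    have wd: "w \<in> dom_of E"
    proof (subst dom_iff[of _ n])
      show "w \<in> ell (V_star K)" using w_out by (auto simp: ell_def)
      show "\<forall>\<beta>\<in>level K n. on_cell \<beta> w \<in> dom_of (Ec \<beta>)"
        using w_self w_other w(1) resistance_space.dom_zero[OF cell_space[OF level_indices]]
        by metis
    qed
    have "\<forall>x\<in>V_level K 0. w x = 0"
      using boundary_Int_cell[OF _ _ n] w(2) w_out by blast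
    with u wd have orth: "energy E u w = 0" by (simp add: harmonic_iff_off harmonic_off_def)
    define v where "v x = u x + w x" for x
    have vd: "v \<in> dom_of E" using dom_add[OF ud wd] by (simp add: v_def[abs_def])
    have rest: "(\<Sum>\<beta>\<in>level K n - {\<alpha>}. cell_energy \<beta> v) = (\<Sum>\<beta>\<in>level K n - {\<alpha>}. cell_energy \<beta> u)"
    proof (intro sum.cong refl)
      fix \<beta> assume "\<beta> \<in> level K n - {\<alpha>}"
      then have w0: "on_cell \<beta> w x = 0" for x using w_other by simp
      have "on_cell \<beta> v x = on_cell \<beta> u x" for x
        using w0[of x] by (auto simp: restr_def v_def split: if_splits)
      then have "on_cell \<beta> v = on_cell \<beta> u" by (rule ext)
      then show "cell_energy \<beta> v = cell_energy \<beta> u" by (simp add: cell_energy_def)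
    qed
    have w_rest: "(\<Sum>\<beta>\<in>level K n - {\<alpha>}. cell_energy \<beta> w) = 0"
      using w_other resistance_space.energy_zero_left[OF cell_space resistance_space.dom_zero[OF cell_space]]
        level_indices
      by (intro sum.neutral) (auto simp: cell_energy_def)
    have parts: "energy E f f = cell_energy \<alpha> f + (\<Sum>\<beta>\<in>level K n - {\<alpha>}. cell_energy \<beta> f)"
      if "f \<in> dom_of E" for f
      using energy_eq_sum[OF that, of n] sum.remove[OF finite_level n] by simp
    have "energy E v v = energy E u u + energy E w w"
      using energy_lincomb[OF ud wd, of 1 1] orth by (simp add: v_def[abs_def])
    then have "cell_energy \<alpha> v = cell_energy \<alpha> u + cell_energy \<alpha> w"
      unfolding parts[OF vd] parts[OF ud] parts[OF wd] rest w_rest by simp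
    moreover have "on_cell \<alpha> v = (\<lambda>x. 1 * on_cell \<alpha> u x + 1 * w x)"
      using w_out by (auto simp: restr_def fun_eq_iff v_def)
    then have "cell_energy \<alpha> v =
        cell_energy \<alpha> u + 2 * energy (Ec \<alpha>) (on_cell \<alpha> u) w + cell_energy \<alpha> w"
      using C.energy_lincomb[OF ucd w(1), of 1 1] by (simp add: cell_energy_def w_self)
    ultimately show ?thesis by simp
  qed
  with ucd show ?thesis by (simp add: harmonic_off_def)
qed

lemma trace_form_harmonic:
  assumes "harmonic K E u" "\<alpha> \<in> indices K" "\<forall>x\<in>vert K \<alpha>. f x = u x"
  shows "trace_form (Ec \<alpha>) (vert K \<alpha>) f = cell_energy \<alpha> u"
  unfolding cell_energy_def
proof (rule resistance_space.trace_form_eq_energy[OF cell_space harmonic_on_cell])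
  show "\<forall>x\<in>vert K \<alpha>. on_cell \<alpha> u x = f x"
    using assms vert_props(2)[OF assms(2)] vert_subset_V_star[OF assms(2)] by (auto simp: restr_def)
qed (use assms in auto)

text \<open>The description that defines \<open>D_mat\<close> is satisfied, because exactly one matrix fits it.\<close>

lemma D_mat_props:
  assumes \<alpha>: "\<alpha> \<in> indices K"
  shows "D_mat K Ec \<alpha> s t = D_mat K Ec \<alpha> t s"
    and "trace_form (Ec \<alpha>) (vert K \<alpha>) f =
      (\<Sum>s\<in>vert K \<alpha>. f s * (\<Sum>t\<in>vert K \<alpha>. D_mat K Ec \<alpha> s t * f t))"
proof -
  let ?P = "\<lambda>D. (\<forall>s t. D s t = D t s) \<and>
     (\<forall>s t. s \<notin> vert K \<alpha> \<or> t \<notin> vert K \<alpha> \<longrightarrow> D s t = 0) \<and>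
     (\<forall>f. trace_form (Ec \<alpha>) (vert K \<alpha>) f = (\<Sum>s\<in>vert K \<alpha>. f s * (\<Sum>t\<in>vert K \<alpha>. D s t * f t)))"
  have "\<exists>D. ?P D"
    using resistance_space.trace_form_matrix[OF cell_space[OF \<alpha>] vert_props(1)[OF \<alpha>]]
      vert_props(2)[OF \<alpha>] vert_subset_V_star[OF \<alpha>] vert_nonempty[OF \<alpha>] by simp
  then obtain D where D: "?P D" by blast
  have "D_mat K Ec \<alpha> = D"
    unfolding D_mat_def
  proof (rule the_equality)
    show "?P D" by (rule D)
    fix D' assume D': "?P D'"
    show "D' = D"
      by (rule symmetric_matrix_unique[OF vert_props(1)[OF \<alpha>],
            where T = "trace_form (Ec \<alpha>) (vert K \<alpha>)"]) (use D D' in blast)+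
  qed
  with D show "D_mat K Ec \<alpha> s t = D_mat K Ec \<alpha> t s"
    and "trace_form (Ec \<alpha>) (vert K \<alpha>) f =
      (\<Sum>s\<in>vert K \<alpha>. f s * (\<Sum>t\<in>vert K \<alpha>. D_mat K Ec \<alpha> s t * f t))" by auto
qed

lemma Z_mat_eq_cell_energy:
  assumes \<alpha>: "\<alpha> \<in> indices K"
  defines "u \<equiv> \<lambda>p. harmonic_ext K E (indicator {p})"
  shows "Z_mat K E Ec \<nu> \<alpha> p q =
    (cell_energy \<alpha> (\<lambda>x. u p x + u q x) / measure \<nu> (cell K \<alpha>)
     - cell_energy \<alpha> (u p) / measure \<nu> (cell K \<alpha>)
     - cell_energy \<alpha> (u q) / measure \<nu> (cell K \<alpha>)) / 2"
proof -
  let ?T = "trace_form (Ec \<alpha>) (vert K \<alpha>)"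
  have u: "harmonic K E (u p)" for p unfolding u_def by (rule harmonic_ext_harmonic)
  have M: "M_mat K E \<alpha> s p = u p s" if "s \<in> vert K \<alpha>" for s p
    using that by (simp add: M_mat_def M_map_def restr_def u_def)
  have "(\<Sum>s\<in>vert K \<alpha>. \<Sum>t\<in>vert K \<alpha>. M_mat K E \<alpha> s p * D_mat K Ec \<alpha> s t * M_mat K E \<alpha> t q) =
     (\<Sum>s\<in>vert K \<alpha>. \<Sum>t\<in>vert K \<alpha>. u p s * D_mat K Ec \<alpha> s t * u q t)"
    by (intro sum.cong refl) (simp add: M)
  also have "\<dots> = (?T (\<lambda>x. u p x + u q x) - ?T (u p) - ?T (u q)) / 2"
    by (rule symmetric_matrix_polarization) (rule D_mat_props[OF \<alpha>])+
  also have "\<dots> = (cell_energy \<alpha> (\<lambda>x. u p x + u q x) - cell_energy \<alpha> (u p) - cell_energy \<alpha> (u q)) / 2"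
  proof -
    have "?T (\<lambda>x. u p x + u q x) = cell_energy \<alpha> (\<lambda>x. u p x + u q x)"
      by (rule trace_form_harmonic[OF harmonic_add[OF u u] \<alpha>]) simp
    moreover have "?T (u p) = cell_energy \<alpha> (u p)" for p
      by (rule trace_form_harmonic[OF u \<alpha>]) simp
    ultimately show ?thesis by simp
  qed
  finally show ?thesis by (simp add: Z_mat_def diff_divide_distrib)
qed

end

section \<open>The Kusuoka measure\<close>

lemma atomless_singleton:
  assumes "atomless M" "{x} \<in> sets M"
  shows "emeasure M {x} = 0"
proof (rule ccontr)
  assume "emeasure M {x} \<noteq> 0"
  then have "emeasure M {x} > 0" by (simp add: zero_less_iff_neq_zero)
  with assms obtain T where T: "T \<subseteq> {x}" "0 < emeasure M T" "emeasure M T < emeasure M {x}"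
    unfolding atomless_def by blast
  from T(1) have "T = {} \<or> T = {x}" by auto
  with T show False by auto
qed

locale kusuoka_fractal = fractal_form K E Ec
  for K :: "('i, 'a::metric_space) fractal" and E :: "'a form" and Ec :: "'i \<Rightarrow> 'a form" +
  fixes h :: "nat \<Rightarrow> 'a \<Rightarrow> real" and \<nu>h :: "nat \<Rightarrow> 'a measure" and \<nu> :: "'a measure"
  assumes basis: "harmonic_basis K E h"
    and energy_measures: "\<And>i. i \<in> {1..card (V_level K 0) - 1} \<Longrightarrow> energy_measure K Ec (h i) (\<nu>h i)"
    and nu_def: "\<nu> = kusuoka_measure K \<nu>h"
begin

definition basis_ix :: "nat set" where
  "basis_ix = {1..card (V_level K 0) - 1}"

lemma finite_basis_ix [simp]: "finite basis_ix"
  by (simp add: basis_ix_def)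

lemma basis_harmonic: "i \<in> basis_ix \<Longrightarrow> harmonic K E (h i)"
  using basis by (simp add: harmonic_basis_def basis_ix_def)

lemma basis_energy_measure: "i \<in> basis_ix \<Longrightarrow> energy_measure K Ec (h i) (\<nu>h i)"
  unfolding basis_ix_def by (rule energy_measures)

lemma basis_energy_nonneg: "i \<in> basis_ix \<Longrightarrow> \<alpha> \<in> indices K \<Longrightarrow> 0 \<le> cell_energy \<alpha> (h i)"
  by (intro cell_energy_nonneg harmonic_dom basis_harmonic)

lemma sets_nu: "sets \<nu> = sets (restrict_space borel (space_F K))"
  and space_nu: "space \<nu> = space_F K"
proof -
  have "sets (restrict_space borel (space_F K)) \<subseteq> Pow (space_F K)"
    by (auto simp: sets_restrict_space)
  moreover have "sigma_algebra (space_F K) (sets (restrict_space borel (space_F K)))"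
    using sets.sigma_algebra_axioms[of "restrict_space borel (space_F K)"]
    by (simp add: space_restrict_space)
  ultimately show "sets \<nu> = sets (restrict_space borel (space_F K))" "space \<nu> = space_F K"
    by (simp_all add: nu_def kusuoka_measure_def sigma_algebra.sigma_sets_eq space_measure_of_conv)
qed

lemma sets_nuh: "i \<in> basis_ix \<Longrightarrow> sets (\<nu>h i) = sets \<nu>"
  using basis_energy_measure by (simp add: energy_measure_def sets_nu)

lemma emeasure_nu:
  assumes "S \<in> sets \<nu>"
  shows "emeasure \<nu> S = (\<Sum>i\<in>basis_ix. emeasure (\<nu>h i) S)"
proof -
  let ?\<Sigma> = "sets (restrict_space borel (space_F K))"
  have sa: "sigma_algebra (space_F K) ?\<Sigma>"
    using sets.sigma_algebra_axioms[of "restrict_space borel (space_F K)"]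
    by (simp add: space_restrict_space)
  show ?thesis
    unfolding nu_def kusuoka_measure_def basis_ix_def[symmetric]
  proof (rule emeasure_measure_of_sigma[OF sa])
    show "positive ?\<Sigma> (\<lambda>S. \<Sum>i\<in>basis_ix. emeasure (\<nu>h i) S)"
      by (simp add: positive_def)
    show "countably_additive ?\<Sigma> (\<lambda>S. \<Sum>i\<in>basis_ix. emeasure (\<nu>h i) S)"
    proof (rule countably_additiveI)
      fix A :: "nat \<Rightarrow> 'a set"
      assume A: "range A \<subseteq> ?\<Sigma>" "disjoint_family A"
      have "(\<Sum>n. \<Sum>i\<in>basis_ix. emeasure (\<nu>h i) (A n)) = (\<Sum>i\<in>basis_ix. \<Sum>n. emeasure (\<nu>h i) (A n))"
        by (rule suminf_sum) simp
      also have "\<dots> = (\<Sum>i\<in>basis_ix. emeasure (\<nu>h i) (\<Union>n. A n))"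
        using A sets_nuh sets_nu by (intro sum.cong refl suminf_emeasure) auto
      finally show "(\<Sum>n. \<Sum>i\<in>basis_ix. emeasure (\<nu>h i) (A n)) =
        (\<Sum>i\<in>basis_ix. emeasure (\<nu>h i) (\<Union>n. A n))" .
    qed
    show "S \<in> ?\<Sigma>" using assms by (simp add: sets_nu)
  qed
qed

lemma closed_in_sets: "closed S \<Longrightarrow> S \<subseteq> space_F K \<Longrightarrow> S \<in> sets \<nu>"
  unfolding sets_nu sets_restrict_space by (intro image_eqI[of _ _ S]) auto

lemma cell_sets: "\<alpha> \<in> indices K \<Longrightarrow> cell K \<alpha> \<in> sets \<nu>"
  using cell_props by (intro closed_in_sets compact_imp_closed)

lemma emeasure_cell:
  assumes \<alpha>: "\<alpha> \<in> indices K"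
  shows "emeasure \<nu> (cell K \<alpha>) = ennreal (\<Sum>i\<in>basis_ix. cell_energy \<alpha> (h i))"
proof -
  have "emeasure \<nu> (cell K \<alpha>) = (\<Sum>i\<in>basis_ix. ennreal (cell_energy \<alpha> (h i)))"
    unfolding emeasure_nu[OF cell_sets[OF \<alpha>]]
    using basis_energy_measure \<alpha> trace_form_harmonic[OF basis_harmonic \<alpha>]
    by (intro sum.cong refl) (simp add: energy_measure_def)
  then show ?thesis
    using basis_energy_nonneg \<alpha> by (simp add: sum_ennreal)
qed

lemma finite_nu: "finite_measure \<nu>"
proof (rule finite_measureI)
  show "emeasure \<nu> (space \<nu>) \<noteq> \<infinity>"
    using emeasure_cell[of "top_ix K"] level_0 level_indices[of "top_ix K" 0]
    by (simp add: cell_top space_nu)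
qed

text \<open>The energy measures are atomless, and \<open>V_*\<close> is countable.\<close>

lemma V_star_null: "V_star K \<in> null_sets \<nu>"
proof -
  have "{x} \<in> null_sets \<nu>" if "x \<in> V_star K" for x
  proof -
    have x: "{x} \<in> sets \<nu>" using that V_star_subset by (intro closed_in_sets) auto
    have "emeasure (\<nu>h i) {x} = 0" if "i \<in> basis_ix" for i
      using basis_energy_measure[OF that] x sets_nuh[OF that]
      by (intro atomless_singleton) (simp_all add: energy_measure_def)
    then have "emeasure \<nu> {x} = 0" unfolding emeasure_nu[OF x] by simp
    with x show ?thesis by auto
  qed
  then have "(\<Union>x\<in>V_star K. {x}) \<in> null_sets \<nu>"
    using countable_V_star by (intro null_sets_UN') auto
  then show ?thesis by simp
qed

section \<open>The energy ratios form a supermartingale\<close>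

definition cell_sigma :: "nat \<Rightarrow> 'a measure" where
  "cell_sigma n = sigma (space_F K) (cell K ` level K n)"

lemma space_cell_sigma: "space (cell_sigma n) = space_F K"
  by (simp add: cell_sigma_def space_measure_of_conv)

lemma cells_Pow: "cell K ` level K n \<subseteq> Pow (space_F K)"
  using cell_props(3) level_indices by blast

lemma sets_cell_sigma: "sets (cell_sigma n) = sigma_sets (space_F K) (cell K ` level K n)"
  unfolding cell_sigma_def by (rule sets_measure_of[OF cells_Pow])

lemma cell_sigma_subset: "sets (cell_sigma n) \<subseteq> sets \<nu>"
  unfolding sets_cell_sigma space_nu[symmetric]
  using cell_sets level_indices by (intro sets.sigma_sets_subset) blast

lemma cell_sigma_mono: "sets (cell_sigma n) \<subseteq> sets (cell_sigma (Suc n))"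
proof -
  have "cell K \<alpha> \<in> sets (cell_sigma (Suc n))" if \<alpha>: "\<alpha> \<in> level K n" for \<alpha>
  proof (rule refinement[OF \<alpha>])
    fix J assume J: "J \<subseteq> level K (Suc n)" "finite J" "cell K \<alpha> = (\<Union>\<beta>\<in>J. cell K \<beta>)"
    show ?thesis unfolding J(3)
    proof (rule sets.finite_UN[OF J(2)])
      fix \<beta> assume "\<beta> \<in> J"
      then show "cell K \<beta> \<in> sets (cell_sigma (Suc n))"
        unfolding sets_cell_sigma using J(1) by (intro sigma_sets.Basic) blast
    qed
  qed
  then have "sigma_sets (space (cell_sigma (Suc n))) (cell K ` level K n) \<subseteq> sets (cell_sigma (Suc n))"
    by (intro sets.sigma_sets_subset) blast
  then show ?thesis by (simp add: sets_cell_sigma space_cell_sigma)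
qed

text \<open>Up to vertices, which are null, the cells of level \<open>n\<close> are the atoms of the \<open>\<sigma>\<close>-algebra that
  they generate. The property passes through the operations of a \<open>\<sigma>\<close>-algebra, so the members need no
  explicit description.\<close>

lemma cell_sigma_trivial_on_cells:
  assumes A: "A \<in> sets (cell_sigma n)" and \<alpha>: "\<alpha> \<in> level K n"
  shows "A \<inter> cell K \<alpha> \<in> null_sets \<nu> \<or> cell K \<alpha> - A \<in> null_sets \<nu>"
proof -
  note cell = cell_sets[OF level_indices[OF \<alpha>]]
  have sub: "A \<in> sets \<nu>" if "A \<in> sigma_sets (space_F K) (cell K ` level K n)" for A
    using that cell_sigma_subset[of n] unfolding sets_cell_sigma by blast
  from A show ?thesis
    unfolding sets_cell_sigma
  proof induction
    case (Basic A)
    then obtain \<gamma> where \<gamma>: "\<gamma> \<in> level K n" "A = cell K \<gamma>" by blast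
    show ?case
    proof (cases "\<gamma> = \<alpha>")
      case True then show ?thesis using \<gamma> by simp
    next
      case False
      have "A \<inter> cell K \<alpha> \<subseteq> V_star K"
        using cells_meet_in_vertices[OF \<gamma>(1) \<alpha> False] vert_subset_V_star[OF level_indices[OF \<alpha>]] \<gamma>(2)
        by blast
      moreover have "A \<inter> cell K \<alpha> \<in> sets \<nu>"
        using cell cell_sets[OF level_indices[OF \<gamma>(1)]] \<gamma>(2) by blast
      ultimately show ?thesis using null_sets_subset[OF V_star_null] by blast
    qed
  next
    case Empty show ?case by simp
  next
    case (Compl A)
    have "(space_F K - A) \<inter> cell K \<alpha> = cell K \<alpha> - A" "cell K \<alpha> - (space_F K - A) = A \<inter> cell K \<alpha>"
      using cell_props(3)[OF level_indices[OF \<alpha>]] by auto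
    with Compl show ?case by auto
  next
    case (Union A)
    have meas: "A i \<in> sets \<nu>" for i using Union.hyps sub by blast
    show ?case
    proof (cases "\<exists>i. cell K \<alpha> - A i \<in> null_sets \<nu>")
      case True
      then obtain i where i: "cell K \<alpha> - A i \<in> null_sets \<nu>" ..
      have "cell K \<alpha> - (\<Union>i. A i) \<in> null_sets \<nu>"
        by (rule null_sets_subset[OF i]) (use cell meas in auto)
      then show ?thesis ..
    next
      case False
      then have "A i \<inter> cell K \<alpha> \<in> null_sets \<nu>" for i using Union.IH by blast
      then have "(\<Union>i. A i \<inter> cell K \<alpha>) \<in> null_sets \<nu>" by (rule null_sets_UN)
      moreover have "(\<Union>i. A i \<inter> cell K \<alpha>) = (\<Union>i. A i) \<inter> cell K \<alpha>" by blast
      ultimately show ?thesis by simp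
    qed
  qed
qed

text \<open>Summing over all cells that contain \<open>x\<close> avoids a choice at the vertices and makes measurability
  obvious. A cell of measure zero contributes nothing, since division by zero gives zero.\<close>

definition energy_ratio :: "('a \<Rightarrow> real) \<Rightarrow> nat \<Rightarrow> 'a \<Rightarrow> real" where
  "energy_ratio u n x =
     (\<Sum>\<alpha>\<in>level K n. cell_energy \<alpha> u / measure \<nu> (cell K \<alpha>) * indicator (cell K \<alpha>) x)"

lemma energy_ratio_integral:
  assumes u: "harmonic K E u" and A: "A \<in> sets \<nu>"
  shows "(\<integral>\<^sup>+x\<in>A. ennreal (energy_ratio u n x) \<partial>\<nu>) =
    (\<Sum>\<alpha>\<in>level K n. ennreal (cell_energy \<alpha> u / measure \<nu> (cell K \<alpha>)) * emeasure \<nu> (A \<inter> cell K \<alpha>))"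
proof -
  have nonneg: "0 \<le> cell_energy \<alpha> u / measure \<nu> (cell K \<alpha>)" if "\<alpha> \<in> level K n" for \<alpha>
    using cell_energy_nonneg[OF _ level_indices[OF that]] u by (simp add: harmonic_def)
  have meas: "A \<inter> cell K \<alpha> \<in> sets \<nu>" if "\<alpha> \<in> level K n" for \<alpha>
    using A cell_sets[OF level_indices[OF that]] by blast
  have "(\<integral>\<^sup>+x\<in>A. ennreal (energy_ratio u n x) \<partial>\<nu>) =
    (\<integral>\<^sup>+x. (\<Sum>\<alpha>\<in>level K n. ennreal (cell_energy \<alpha> u / measure \<nu> (cell K \<alpha>)) *
      indicator (A \<inter> cell K \<alpha>) x) \<partial>\<nu>)"
  proof (rule nn_integral_cong)
    fix x
    have "ennreal (energy_ratio u n x) =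
        (\<Sum>\<alpha>\<in>level K n. ennreal (cell_energy \<alpha> u / measure \<nu> (cell K \<alpha>) * indicator (cell K \<alpha>) x))"
      unfolding energy_ratio_def using nonneg by (intro sum_ennreal[symmetric]) (simp add: indicator_def)
    then show "ennreal (energy_ratio u n x) * indicator A x =
      (\<Sum>\<alpha>\<in>level K n. ennreal (cell_energy \<alpha> u / measure \<nu> (cell K \<alpha>)) * indicator (A \<inter> cell K \<alpha>) x)"
      by (auto simp: sum_distrib_right indicator_def intro!: sum.cong)
  qed
  also have "\<dots> = (\<Sum>\<alpha>\<in>level K n. \<integral>\<^sup>+x. ennreal (cell_energy \<alpha> u / measure \<nu> (cell K \<alpha>)) *
      indicator (A \<inter> cell K \<alpha>) x \<partial>\<nu>)"
    using meas by (intro nn_integral_sum borel_measurable_times_ennreal) auto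
  also have "\<dots> = (\<Sum>\<alpha>\<in>level K n. ennreal (cell_energy \<alpha> u / measure \<nu> (cell K \<alpha>)) *
      emeasure \<nu> (A \<inter> cell K \<alpha>))"
    using meas by (intro sum.cong refl nn_integral_cmult_indicator)
  finally show ?thesis .
qed

lemma ratio_times_measure:
  assumes u: "harmonic K E u" and \<alpha>: "\<alpha> \<in> indices K" and pos: "emeasure \<nu> (cell K \<alpha>) \<noteq> 0"
  shows "ennreal (cell_energy \<alpha> u / measure \<nu> (cell K \<alpha>)) * emeasure \<nu> (cell K \<alpha>) =
    ennreal (cell_energy \<alpha> u)"
proof -
  interpret finite_measure \<nu> by (rule finite_nu)
  have "measure \<nu> (cell K \<alpha>) \<noteq> 0" using pos by (simp add: emeasure_eq_measure)
  moreover have "0 \<le> cell_energy \<alpha> u" by (intro cell_energy_nonneg harmonic_dom u \<alpha>)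
  ultimately show ?thesis by (simp add: emeasure_eq_measure ennreal_mult[symmetric])
qed

lemma ratio_times_measure_le:
  assumes "harmonic K E u" "\<alpha> \<in> indices K"
  shows "ennreal (cell_energy \<alpha> u / measure \<nu> (cell K \<alpha>)) * emeasure \<nu> (cell K \<alpha>) \<le>
    ennreal (cell_energy \<alpha> u)"
  using ratio_times_measure[OF assms] by (cases "emeasure \<nu> (cell K \<alpha>) = 0") auto

text \<open>By \<open>cell_sigma_trivial_on_cells\<close> it is enough to compare the integrals over a single cell of
  level \<open>n\<close> that has positive measure. On the right this is the energy of \<open>u\<close> on the cell, on the
  left the sum of the energies on those children that have positive measure.\<close>

lemma energy_ratio_supermartingale:
  assumes u: "harmonic K E u" and A: "A \<in> sets (cell_sigma n)"
  shows "(\<integral>\<^sup>+x\<in>A. ennreal (energy_ratio u (Suc n) x) \<partial>\<nu>) \<le> (\<integral>\<^sup>+x\<in>A. ennreal (energy_ratio u n x) \<partial>\<nu>)"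
proof -
  let ?r = "\<lambda>\<alpha>. ennreal (cell_energy \<alpha> u / measure \<nu> (cell K \<alpha>))"
  have A\<nu>: "A \<in> sets \<nu>" using A cell_sigma_subset by blast
  have "(\<Sum>\<beta>\<in>children n \<alpha>. ?r \<beta> * emeasure \<nu> (A \<inter> cell K \<beta>)) \<le> ?r \<alpha> * emeasure \<nu> (A \<inter> cell K \<alpha>)"
    if \<alpha>: "\<alpha> \<in> level K n" for \<alpha>
  proof -
    have ch: "\<beta> \<in> indices K" "cell K \<beta> \<subseteq> cell K \<alpha>" if "\<beta> \<in> children n \<alpha>" for \<beta>
      using that level_indices by (auto simp: children_def)
    have cells: "cell K \<alpha> \<in> sets \<nu>" "\<And>\<beta>. \<beta> \<in> children n \<alpha> \<Longrightarrow> cell K \<beta> \<in> sets \<nu>"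
      using cell_sets level_indices[OF \<alpha>] ch(1) by auto
    consider "A \<inter> cell K \<alpha> \<in> null_sets \<nu>"
      | "cell K \<alpha> - A \<in> null_sets \<nu>" "A \<inter> cell K \<alpha> \<notin> null_sets \<nu>"
      using cell_sigma_trivial_on_cells[OF A \<alpha>] by blast
    then show ?thesis
    proof cases
      case 1
      have "emeasure \<nu> (A \<inter> cell K \<beta>) = 0" if "\<beta> \<in> children n \<alpha>" for \<beta>
        using null_sets_subset[OF 1, of "A \<inter> cell K \<beta>"] A\<nu> cells(2)[OF that] ch(2)[OF that] by blast
      then show ?thesis by simp
    next
      case 2
      have "emeasure \<nu> (cell K \<alpha>) = emeasure \<nu> (cell K \<alpha> - (cell K \<alpha> - A))"
        by (rule emeasure_Diff_null_set[OF 2(1) cells(1), symmetric])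
      also have "cell K \<alpha> - (cell K \<alpha> - A) = A \<inter> cell K \<alpha>" by blast
      finally have full: "emeasure \<nu> (A \<inter> cell K \<alpha>) = emeasure \<nu> (cell K \<alpha>)" ..
      have pos: "emeasure \<nu> (cell K \<alpha>) \<noteq> 0"
        using 2(2) A\<nu> cells(1) full by (auto simp: null_sets_def)
      have dom: "u \<in> dom_of E" by (rule harmonic_dom[OF u])
      have "(\<Sum>\<beta>\<in>children n \<alpha>. ?r \<beta> * emeasure \<nu> (A \<inter> cell K \<beta>)) \<le>
          (\<Sum>\<beta>\<in>children n \<alpha>. ?r \<beta> * emeasure \<nu> (cell K \<beta>))"
        using cells(2) by (intro sum_mono mult_left_mono emeasure_mono) auto
      also have "\<dots> \<le> (\<Sum>\<beta>\<in>children n \<alpha>. ennreal (cell_energy \<beta> u))"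
        using ch(1) by (intro sum_mono ratio_times_measure_le[OF u])
      also have "\<dots> = ennreal (cell_energy \<alpha> u)"
        unfolding cell_energy_children[OF dom \<alpha>]
        using ch(1) dom by (intro sum_ennreal cell_energy_nonneg)
      also have "\<dots> = ?r \<alpha> * emeasure \<nu> (A \<inter> cell K \<alpha>)"
        unfolding full by (rule ratio_times_measure[OF u level_indices[OF \<alpha>] pos, symmetric])
      finally show ?thesis .
    qed
  qed
  then show ?thesis
    unfolding energy_ratio_integral[OF u A\<nu>] sum_over_children by (rule sum_mono)
qed

lemma energy_ratio_convergent:
  assumes u: "harmonic K E u"
  shows "AE x in \<nu>. convergent (\<lambda>n. energy_ratio u n x)"
proof (rule finite_measure.nonneg_supermartingale_AE_convergent[OF finite_nu, where F = cell_sigma])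
  interpret finite_measure \<nu> by (rule finite_nu)
  show "space (cell_sigma n) = space \<nu>" for n by (simp add: space_cell_sigma space_nu)
  show "sets (cell_sigma n) \<subseteq> sets \<nu>" for n by (rule cell_sigma_subset)
  show "sets (cell_sigma n) \<subseteq> sets (cell_sigma (Suc n))" for n by (rule cell_sigma_mono)
  show "energy_ratio u n \<in> borel_measurable (cell_sigma n)" for n
    unfolding energy_ratio_def[abs_def]
    by (intro borel_measurable_sum borel_measurable_times borel_measurable_const
          borel_measurable_indicator) (simp add: sets_cell_sigma)
  show "0 \<le> energy_ratio u n x" for n x
    unfolding energy_ratio_def using u level_indices cell_energy_nonneg
    by (intro sum_nonneg mult_nonneg_nonneg divide_nonneg_nonneg) (auto simp: harmonic_def)
  show "(\<integral>\<^sup>+x\<in>A. ennreal (energy_ratio u (Suc n) x) \<partial>\<nu>) \<le> (\<integral>\<^sup>+x\<in>A. ennreal (energy_ratio u n x) \<partial>\<nu>)"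
    if "A \<in> sets (cell_sigma n)" for n A by (rule energy_ratio_supermartingale[OF u that])
  have "(\<integral>\<^sup>+x. ennreal (energy_ratio u 0 x) \<partial>\<nu>) = (\<integral>\<^sup>+x\<in>space \<nu>. ennreal (energy_ratio u 0 x) \<partial>\<nu>)"
    by (rule nn_integral_cong) simp
  also have "\<dots> < \<infinity>"
    unfolding energy_ratio_integral[OF u sets.top] using finite_level
    by (simp add: emeasure_eq_measure ennreal_mult_less_top)
  finally show "(\<integral>\<^sup>+x. ennreal (energy_ratio u 0 x) \<partial>\<nu>) < \<infinity>" .
qed

section \<open>Convergence of the matrices\<close>

lemma Z_index_unique:
  assumes "Z_index K \<nu> n x \<alpha>" "\<beta> \<in> level K n" "x \<in> cell K \<beta>"
  shows "\<beta> = \<alpha>"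
  using assms cells_meet_in_vertices[of \<alpha> n \<beta>] unfolding Z_index_def by blast

lemma energy_ratio_at:
  assumes "Z_index K \<nu> n x \<alpha>"
  shows "energy_ratio u n x = cell_energy \<alpha> u / measure \<nu> (cell K \<alpha>)"
proof -
  have "energy_ratio u n x =
      (\<Sum>\<beta>\<in>level K n. if \<beta> = \<alpha> then cell_energy \<alpha> u / measure \<nu> (cell K \<alpha>) else 0)"
    unfolding energy_ratio_def
  proof (intro sum.cong refl)
    fix \<beta> assume \<beta>: "\<beta> \<in> level K n"
    have "x \<in> cell K \<beta> \<longleftrightarrow> \<beta> = \<alpha>"
      using Z_index_unique[OF assms \<beta>] assms by (auto simp: Z_index_def)
    then show "cell_energy \<beta> u / measure \<nu> (cell K \<beta>) * indicator (cell K \<beta>) x =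
        (if \<beta> = \<alpha> then cell_energy \<alpha> u / measure \<nu> (cell K \<alpha>) else 0)"
      by (simp add: indicator_def)
  qed
  then show ?thesis using assms finite_level by (simp add: Z_index_def)
qed

lemma AE_Z_index: "AE x in \<nu>. \<forall>n. \<exists>\<alpha>. Z_index K \<nu> n x \<alpha>"
proof -
  have "AE x in \<nu>. \<forall>\<alpha>\<in>level K n. emeasure \<nu> (cell K \<alpha>) = 0 \<longrightarrow> x \<notin> cell K \<alpha>" for n
  proof (rule AE_finite_allI[OF finite_level])
    fix \<alpha> assume "\<alpha> \<in> level K n"
    then have "cell K \<alpha> \<in> sets \<nu>" by (intro cell_sets level_indices)
    then show "AE x in \<nu>. emeasure \<nu> (cell K \<alpha>) = 0 \<longrightarrow> x \<notin> cell K \<alpha>"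
      by (cases "emeasure \<nu> (cell K \<alpha>) = 0") (auto intro!: AE_not_in)
  qed
  then have "AE x in \<nu>. \<forall>n. \<forall>\<alpha>\<in>level K n. emeasure \<nu> (cell K \<alpha>) = 0 \<longrightarrow> x \<notin> cell K \<alpha>"
    by (simp add: AE_all_countable)
  then show ?thesis using AE_not_in[OF V_star_null] AE_space
  proof eventually_elim
    case (elim x)
    show ?case
    proof
      fix n
      obtain \<alpha> where \<alpha>: "\<alpha> \<in> level K n" "x \<in> cell K \<alpha>"
        using elim(3) cells_cover[of n] by (auto simp: space_nu)
      then have "Z_index K \<nu> n x \<alpha>"
        using elim vert_subset_V_star[OF level_indices] unfolding Z_index_def by blast
      then show "\<exists>\<alpha>. Z_index K \<nu> n x \<alpha>" ..
    qed
  qed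
qed

lemma Z_fun_eq_energy_ratio:
  assumes "Z_index K \<nu> n x \<alpha>"
  defines "u \<equiv> \<lambda>p. harmonic_ext K E (indicator {p})"
  shows "Z_fun K E Ec \<nu> n x p q =
    (energy_ratio (\<lambda>x. u p x + u q x) n x - energy_ratio (u p) n x - energy_ratio (u q) n x) / 2"
proof -
  have "(THE \<alpha>. Z_index K \<nu> n x \<alpha>) = \<alpha>"
    using assms(1) Z_index_unique[OF assms(1)] by (intro the_equality) (auto simp: Z_index_def)
  moreover have "\<alpha> \<in> indices K" using assms(1) level_indices by (auto simp: Z_index_def)
  ultimately show ?thesis
    unfolding Z_fun_def energy_ratio_at[OF assms(1)] u_def by (simp only: Z_mat_eq_cell_energy)
qed

lemma AE_Z_fun_convergent:
  "AE x in \<nu>. (\<forall>n. \<exists>\<alpha>. Z_index K \<nu> n x \<alpha>) \<and>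
     (\<exists>Z :: 'a \<Rightarrow> 'a \<Rightarrow> real. \<forall>p\<in>V_level K 0. \<forall>q\<in>V_level K 0.
        (\<lambda>n. Z_fun K E Ec \<nu> n x p q) \<longlonglongrightarrow> Z p q)"
proof -
  define u where "u p = harmonic_ext K E (indicator {p})" for p
  have u: "harmonic K E (u p)" for p unfolding u_def by (rule harmonic_ext_harmonic)
  have "AE x in \<nu>. \<forall>p\<in>V_level K 0. convergent (\<lambda>n. energy_ratio (u p) n x)"
    by (intro AE_finite_allI V_level_0 energy_ratio_convergent u)
  moreover have "AE x in \<nu>. \<forall>p\<in>V_level K 0. \<forall>q\<in>V_level K 0.
      convergent (\<lambda>n. energy_ratio (\<lambda>x. u p x + u q x) n x)"
    by (intro AE_finite_allI V_level_0 energy_ratio_convergent harmonic_add u)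
  ultimately show ?thesis using AE_Z_index
  proof eventually_elim
    case (elim x)
    have "(\<lambda>n. Z_fun K E Ec \<nu> n x p q) \<longlonglongrightarrow> lim (\<lambda>n. Z_fun K E Ec \<nu> n x p q)"
      if pq: "p \<in> V_level K 0" "q \<in> V_level K 0" for p q
    proof -
      obtain a b c where "(\<lambda>n. energy_ratio (\<lambda>x. u p x + u q x) n x) \<longlonglongrightarrow> a"
          "(\<lambda>n. energy_ratio (u p) n x) \<longlonglongrightarrow> b" "(\<lambda>n. energy_ratio (u q) n x) \<longlonglongrightarrow> c"
        using elim(1,2) pq unfolding convergent_def by blast
      then have "(\<lambda>n. (energy_ratio (\<lambda>x. u p x + u q x) n x
          - energy_ratio (u p) n x - energy_ratio (u q) n x) / 2) \<longlonglongrightarrow> (a - b - c) / 2"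
        by (intro tendsto_divide tendsto_diff tendsto_const) auto
      moreover have "Z_fun K E Ec \<nu> n x p q = (energy_ratio (\<lambda>x. u p x + u q x) n x
          - energy_ratio (u p) n x - energy_ratio (u q) n x) / 2" for n
        using Z_fun_eq_energy_ratio elim(3) unfolding u_def by blast
      ultimately have "(\<lambda>n. Z_fun K E Ec \<nu> n x p q) \<longlonglongrightarrow> (a - b - c) / 2" by (simp only:)
      then show ?thesis by (simp add: limI)
    qed
    then have "\<forall>p\<in>V_level K 0. \<forall>q\<in>V_level K 0. (\<lambda>n. Z_fun K E Ec \<nu> n x p q)
        \<longlonglongrightarrow> lim (\<lambda>n. Z_fun K E Ec \<nu> n x p q)" by blast
    with elim(3) show ?case by (intro conjI exI[of _ "\<lambda>p q. lim (\<lambda>n. Z_fun K E Ec \<nu> n x p q)"])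
  qed
qed

end

theorem theorem1:
  fixes K :: "('i, 'a::metric_space) fractal"
    and E :: "'a form"
    and Ec :: "'i \<Rightarrow> 'a form"
    and h :: "nat \<Rightarrow> 'a \<Rightarrow> real"
    and \<nu>h :: "nat \<Rightarrow> 'a measure"
    and \<nu> :: "'a measure"
  assumes "finitely_ramified_fractal K"
    and "resistance_form (V_star K) E"
    and "splits_over_cells K E Ec"
    and "\<And>u. harmonic K E u \<Longrightarrow> extends_continuously K u"
    and "harmonic_basis K E h"
    and "\<And>i. i \<in> {1..card (V_level K 0) - 1} \<Longrightarrow> energy_measure K Ec (h i) (\<nu>h i)"
    and "\<nu> = kusuoka_measure K \<nu>h"
  shows "AE x in \<nu>. (\<forall>n. \<exists>\<alpha>. Z_index K \<nu> n x \<alpha>) \<and>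
           (\<exists>Z :: 'a \<Rightarrow> 'a \<Rightarrow> real. \<forall>p\<in>V_level K 0. \<forall>q\<in>V_level K 0.
              (\<lambda>n. Z_fun K E Ec \<nu> n x p q) \<longlonglongrightarrow> Z p q)"
proof -
  interpret kusuoka_fractal K E Ec h \<nu>h \<nu>
    using assms(1,2,3,5,6,7) by unfold_locales
  show ?thesis by (rule AE_Z_fun_convergent)
qed

end
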